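(* Let $X$ and $Y$ be irreducible sofic shifts of equal topological entropy, and let $(\Sigma_Y,\pi_Y)$ be the minimal right-resolving cover of $Y$. There exists a steady factor map $f:X\to Y$ which is right-closing almost-everywhere if and only if there exists a factor map $\varphi:X\to\Sigma_Y$ which is right-continuing with some retract $n\ge0$.
   Context: Subshifts are closed shift-invariant subsets of $A^{\mathbb Z}$, $A$ finite, with shift $\sigma(x)_i=x_{i+1}$; a factor map is a continuous, shift-commuting, onto map; SFT means shift of finite type. A factor map $f:X\to Y$ between irreducible sofic shifts is steady if there is an SFT $T\supseteq X$ such that the sliding block code defining $f$ is defined on $T$ and $f(T)=f(X)=Y$. A point $x$ is left-transitive in $X$ if $\{\sigma^i(x):i\le0\}$ is dense in $X$; $x,y$ are left-asymptotic if $x_i=y_i$ for all $i\le n$ for some $n$. $f$ is right-closing almost-everywhere if for all left-transitive, left-asymptotic $x,y\in X$, $f(x)=f(y)$ implies $x=y$. For $n\ge0$, a factor map $g:X\to Z$ is right-continuing with retract $n$ if for every $x\in X$ and every $z\in Z$ with $g(x)_i=z_i$ for all $i\le n$ there is $x'\in X$ with $x'_i=x_i$ for all $i\le0$ and $g(x')=z$. The minimal right-resolving (Fischer) cover $(\Sigma_Y,\pi_Y)$ of an irreducible sofic shift $Y$ is the (unique up to conjugacy) pair of an irreducible one-step SFT $\Sigma_Y$ and a one-block factor map $\pi_Y:\Sigma_Y\to Y$ that is right-resolving (if $ab,ac$ are $\Sigma_Y$-words with $\pi_Y(b)=\pi_Y(c)$ then $b=c$) and follower-separated (distinct symbols $a\neq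 b$ have distinct sets $\{\pi_Y(aw): aw \text{ a } \Sigma_Y\text{-word}\}$). *)

theory Defs
  imports Complex_Main
begin

definition shift :: "(int \<Rightarrow> 'a) \<Rightarrow> (int \<Rightarrow> 'a)" where
  "shift x = (\<lambda>i. x (i + 1))"

definition word :: "(int \<Rightarrow> 'a) \<Rightarrow> int \<Rightarrow> nat \<Rightarrow> 'a list" where
  "word x i n = map (\<lambda>k. x (i + int k)) [0..<n]"

definition occurs :: "'a list \<Rightarrow> (int \<Rightarrow> 'a) \<Rightarrow> bool" where
  "occurs w x \<longleftrightarrow> (\<exists>i. word x i (length w) = w)"

definition lang :: "(int \<Rightarrow> 'a) set \<Rightarrow> 'a list set" where
  "lang X = {w. \<exists>x\<in>X. occurs w x}"

definition agree :: "(int \<Rightarrow> 'a) \<Rightarrow> (int \<Rightarrow> 'a) \<Rightarrow> nat \<Rightarrow> bool" where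
  "agree x y N \<longleftrightarrow> (\<forall>i. \<bar>i\<bar> \<le> int N \<longrightarrow> x i = y i)"

text \<open>Closedness in the product topology (discrete alphabet).\<close>
definition shift_closed :: "(int \<Rightarrow> 'a) set \<Rightarrow> bool" where
  "shift_closed X \<longleftrightarrow> (\<forall>x. (\<forall>N. \<exists>y\<in>X. agree x y N) \<longrightarrow> x \<in> X)"

definition subshift :: "(int \<Rightarrow> 'a) set \<Rightarrow> bool" where
  "subshift X \<longleftrightarrow> shift ` X = X \<and> shift_closed X"

definition sft_on :: "'a set \<Rightarrow> (int \<Rightarrow> 'a) set \<Rightarrow> bool" where
  "sft_on A T \<longleftrightarrow> finite A \<and>
     (\<exists>F. finite F \<and> T = {x. range x \<subseteq> A \<and> (\<forall>w\<in>F. \<not> occurs w x)})"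

abbreviation SFT :: "(int \<Rightarrow> 'a::finite) set \<Rightarrow> bool" where
  "SFT T \<equiv> sft_on UNIV T"

definition factor_map :: "((int \<Rightarrow> 'a) \<Rightarrow> (int \<Rightarrow> 'b)) \<Rightarrow> (int \<Rightarrow> 'a) set \<Rightarrow> (int \<Rightarrow> 'b) set \<Rightarrow> bool" where
  "factor_map f X Y \<longleftrightarrow> f ` X = Y \<and> (\<forall>x\<in>X. f (shift x) = shift (f x)) \<and>
     (\<forall>x\<in>X. \<forall>N. \<exists>M. \<forall>y\<in>X. agree x y M \<longrightarrow> agree (f x) (f y) N)"

text \<open>Sofic: subshift which is a factor of an SFT (over some finite alphabet, coded in nat).\<close>
definition sofic :: "(int \<Rightarrow> 'a) set \<Rightarrow> bool" where
  "sofic X \<longleftrightarrow> subshift X \<and>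
     (\<exists>(T :: (int \<Rightarrow> nat) set) A g. sft_on A T \<and> factor_map g T X)"

definition irreducible :: "(int \<Rightarrow> 'a) set \<Rightarrow> bool" where
  "irreducible X \<longleftrightarrow> X \<noteq> {} \<and> (\<forall>u\<in>lang X. \<forall>v\<in>lang X. \<exists>w. u @ w @ v \<in> lang X)"

definition entropy :: "(int \<Rightarrow> 'a) set \<Rightarrow> real" where
  "entropy X = lim (\<lambda>n. ln (real (card {w\<in>lang X. length w = n})) / real n)"

definition code :: "('a list \<Rightarrow> 'b) \<Rightarrow> nat \<Rightarrow> nat \<Rightarrow> (int \<Rightarrow> 'a) \<Rightarrow> (int \<Rightarrow> 'b)" where
  "code Phi m a x = (\<lambda>i. Phi (word x (i - int m) (m + a + 1)))"

text \<open>Steady: the block map defining f (whose domain is the X-words of the window length)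
  is defined on an SFT T containing X, and maps T onto Y.\<close>
definition steady :: "((int \<Rightarrow> 'a::finite) \<Rightarrow> (int \<Rightarrow> 'b)) \<Rightarrow> (int \<Rightarrow> 'a) set \<Rightarrow> (int \<Rightarrow> 'b) set \<Rightarrow> bool" where
  "steady f X Y \<longleftrightarrow> factor_map f X Y \<and>
     (\<exists>T Phi m a. SFT T \<and> X \<subseteq> T \<and>
        (\<forall>x\<in>T. \<forall>i. word x (i - int m) (m + a + 1) \<in> lang X) \<and>
        (\<forall>x\<in>X. f x = code Phi m a x) \<and> code Phi m a ` T = Y)"

definition left_transitive :: "(int \<Rightarrow> 'a) set \<Rightarrow> (int \<Rightarrow> 'a) \<Rightarrow> bool" where
  "left_transitive X x \<longleftrightarrow> x \<in> X \<and>
     (\<forall>y\<in>X. \<forall>N. \<exists>i\<le>0. agree (\<lambda>j. x (j + i)) y N)"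

definition left_asymptotic :: "(int \<Rightarrow> 'a) \<Rightarrow> (int \<Rightarrow> 'a) \<Rightarrow> bool" where
  "left_asymptotic x y \<longleftrightarrow> (\<exists>n. \<forall>i\<le>n. x i = y i)"

definition right_closing_ae :: "((int \<Rightarrow> 'a) \<Rightarrow> (int \<Rightarrow> 'b)) \<Rightarrow> (int \<Rightarrow> 'a) set \<Rightarrow> bool" where
  "right_closing_ae f X \<longleftrightarrow> (\<forall>x\<in>X. \<forall>y\<in>X.
     left_transitive X x \<and> left_transitive X y \<and> left_asymptotic x y \<and> f x = f y \<longrightarrow> x = y)"

definition right_continuing :: "((int \<Rightarrow> 'a) \<Rightarrow> (int \<Rightarrow> 'c)) \<Rightarrow> (int \<Rightarrow> 'a) set \<Rightarrow> (int \<Rightarrow> 'c) set \<Rightarrow> nat \<Rightarrow> bool" where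
  "right_continuing g X Z n \<longleftrightarrow> factor_map g X Z \<and>
     (\<forall>x\<in>X. \<forall>z\<in>Z. (\<forall>i\<le>int n. g x i = z i) \<longrightarrow>
        (\<exists>x'\<in>X. (\<forall>i\<le>0. x' i = x i) \<and> g x' = z))"

definition fischer_cover :: "(int \<Rightarrow> 'b) set \<Rightarrow> (int \<Rightarrow> 'c::finite) set \<Rightarrow> ('c \<Rightarrow> 'b) \<Rightarrow> bool" where
  "fischer_cover Y S p \<longleftrightarrow>
     (\<exists>E. S = {x. \<forall>i. (x i, x (i + 1)) \<in> E}) \<and> irreducible S \<and>
     (\<lambda>x. p \<circ> x) ` S = Y \<and>
     (\<forall>a b c. [a, b] \<in> lang S \<and> [a, c] \<in> lang S \<and> p b = p c \<longrightarrow> b = c) \<and>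
     (\<forall>a b. [a] \<in> lang S \<and> [b] \<in> lang S \<and> a \<noteq> b \<longrightarrow>
        {map p (a # w) | w. a # w \<in> lang S} \<noteq> {map p (b # w) | w. b # w \<in> lang S})"

end

theory Submission
  imports Defs "HOL-Library.Countable" "HOL-Library.Infinite_Set"
begin

text \<open>Suppose \<open>f\<close> is right-closing almost-everywhere. On left-transitive points, follower set, recent
  past and finitely many future outputs form a finite state on which \<open>f\<close> is right-resolving, and a
  magic-word argument shows that every continuation in \<open>Y\<close> of the image of a left-transitive past
  lifts. A left-transitive \<open>f(x)\<close> has a unique lift to the Fischer cover; since \<open>f\<close> extends to an
  SFT with the same image, the follower set of the lift is read off a finite window of \<open>x\<close>, so the
  lift is a sliding block code, and it inherits right-continuation.

  Conversely \<open>f = \<pi>\<^sub>Y \<circ> \<phi>\<close> is steady because \<open>\<Sigma>\<^sub>Y\<close> is one-step. If it is not right-closing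
  almost-everywhere, there are two left-asymptotic points with the same image under \<open>\<phi>\<close>, and
  right-continuation allows every preimage to be rewritten so as to avoid some word of \<open>X\<close>; then
  \<open>Y\<close> would have smaller entropy than \<open>X\<close>.\<close>

section \<open>Shift spaces and block maps\<close>

text \<open>Right-closing almost-everywhere speaks only about left-transitive points, and these do
  not form a closed set, so a limit may fall outside the hypothesis. The way out is to transplant
  pasts: a sofic shift has finitely many follower sets, so along a subsequence all pasts can be
  replaced by one fixed left-transitive past, which every limit then inherits. What holds at
  left-transitive points reaches the rest of \<open>X\<close> by density and compactness.

  Steadiness makes the lift local because two points of \<open>X\<close> that agree on a long window
  need not glue inside \<open>X\<close>, but do glue inside the finite type extension, and the image
  of the glued point is still in \<open>Y\<close>. Follower sets in the Fischer cover see nothing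
  but \<open>Y\<close>.

  The converse needs a count finer than growth rates: an irreducible sofic shift has
  \<open>exp (h * n)\<close> words of length \<open>n\<close> up to a constant factor, so a loss of
  a factor \<open>n + 1\<close> by avoiding a word is already incompatible with equal
  entropies.\<close>

definition tr :: "int \<Rightarrow> (int \<Rightarrow> 'a) \<Rightarrow> (int \<Rightarrow> 'a)" where
  "tr k x = (\<lambda>i. x (i + k))"

definition glue :: "(int \<Rightarrow> 'a) \<Rightarrow> (int \<Rightarrow> 'a) \<Rightarrow> (int \<Rightarrow> 'a)" where
  "glue x y = (\<lambda>i. if i < 0 then x i else y i)"

lemma tr_apply [simp]: "tr k x i = x (i + k)"
  by (simp add: tr_def)

lemma tr_tr [simp]: "tr k (tr l x) = tr (k + l) x"
  by (simp add: tr_def add.assoc)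

lemma tr_0 [simp]: "tr 0 x = x"
  by (simp add: tr_def)

lemma glue_neg [simp]: "i < 0 \<Longrightarrow> glue x y i = x i"
  and glue_nonneg [simp]: "i \<ge> 0 \<Longrightarrow> glue x y i = y i"
  by (simp_all add: glue_def)

lemma glue_same [simp]: "glue x x = x"
  by (simp add: glue_def)

lemma shift_eq_tr: "shift = tr 1"
  by (simp add: shift_def tr_def fun_eq_iff)

lemma word_nth [simp]: "k < n \<Longrightarrow> word x i n ! k = x (i + int k)"
  by (simp add: word_def)

lemma length_word [simp]: "length (word x i n) = n"
  by (simp add: word_def)

lemma word_eq_iff: "word x i n = word y j n \<longleftrightarrow> (\<forall>k<n. x (i + int k) = y (j + int k))"
  by (simp add: list_eq_iff_nth_eq)

lemma word_eq_list_iff: "word x i (length w) = w \<longleftrightarrow> (\<forall>k<length w. x (i + int k) = w ! k)"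
  by (simp add: list_eq_iff_nth_eq)

lemma word_tr [simp]: "word (tr k x) i n = word x (i + k) n"
  by (simp add: list_eq_iff_nth_eq algebra_simps)

lemma word_append: "word x i (m + n) = word x i m @ word x (i + int m) n"
  by (auto simp: list_eq_iff_nth_eq nth_append algebra_simps)

lemma agreeD: "agree x y N \<Longrightarrow> \<bar>i\<bar> \<le> int N \<Longrightarrow> x i = y i"
  by (simp add: agree_def)

lemma subshift_tr:
  assumes "subshift X" "x \<in> X"
  shows "tr k x \<in> X"
proof -
  have im: "tr 1 ` X = X"
    using assms(1) by (simp add: subshift_def shift_eq_tr)
  have pos: "tr (int n) y \<in> X" if "y \<in> X" for n y
  proof (induction n)
    case 0
    then show ?case using that by simp
  next
    case (Suc n)
    have "tr 1 (tr (int n) y) \<in> X" using im Suc by blast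
    then show "tr (int (Suc n)) y \<in> X" by simp
  qed
  have neg1: "tr (-1) y \<in> X" if "y \<in> X" for y
  proof -
    have "y \<in> tr 1 ` X" using that im by simp
    then obtain z where "z \<in> X" "y = tr 1 z" by auto
    then show ?thesis by simp
  qed
  have neg: "tr (- int n) y \<in> X" if "y \<in> X" for n y
  proof (induction n)
    case 0
    then show ?case using that by simp
  next
    case (Suc n)
    have "tr (-1) (tr (- int n) y) \<in> X" using neg1 Suc by blast
    moreover have "-1 + - int n = - int (Suc n)" by simp
    ultimately show "tr (- int (Suc n)) y \<in> X" unfolding tr_tr by metis
  qed
  show ?thesis
  proof (cases "k \<ge> 0")
    case True
    then show ?thesis using pos[OF assms(2), of "nat k"] by simp
  next
    case False
    then show ?thesis using neg[OF assms(2), of "nat (-k)"] by simp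
  qed
qed

lemma subshift_closedD:
  assumes "subshift X" "\<And>N. \<exists>y\<in>X. agree x y N"
  shows "x \<in> X"
  using assms by (auto simp: subshift_def shift_closed_def)

lemma factor_map_tr:
  assumes f: "factor_map f X Y" and X: "subshift X" and x: "x \<in> X"
  shows "f (tr k x) = tr k (f x)"
proof -
  have c: "f (tr 1 y) = tr 1 (f y)" if "y \<in> X" for y
    using f that by (simp add: factor_map_def shift_eq_tr)
  have pos: "f (tr (int n) y) = tr (int n) (f y)" if "y \<in> X" for n y
  proof (induction n)
    case 0
    then show ?case by simp
  next
    case (Suc n)
    have "f (tr 1 (tr (int n) y)) = tr 1 (f (tr (int n) y))"
      using c[OF subshift_tr[OF X that]] .
    moreover have "f (tr (int n) y) = tr (int n) (f y)" by (rule Suc.IH)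
    ultimately show "f (tr (int (Suc n)) y) = tr (int (Suc n)) (f y)" by simp
  qed
  show ?thesis
  proof (cases "k \<ge> 0")
    case True
    then show ?thesis using pos[OF x, of "nat k"] by simp
  next
    case False
    have "f (tr (int (nat (-k))) (tr k x)) = tr (int (nat (-k))) (f (tr k x))"
      by (rule pos[OF subshift_tr[OF X x]])
    then have "f x = tr (-k) (f (tr k x))" using False by simp
    then have "tr k (f x) = tr k (tr (-k) (f (tr k x)))" by simp
    then show ?thesis by simp
  qed
qed

section \<open>Compactness and uniform locality of factor maps\<close>

lemma cluster_point:
  fixes xs :: "nat \<Rightarrow> int \<Rightarrow> 'a"
  assumes A: "finite A" "\<And>n i. xs n i \<in> A"
  obtains x where "\<And>N k. \<exists>n\<ge>k. agree x (xs n) N"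
proof -
  define P where "P N I \<longleftrightarrow> infinite I \<and> (\<forall>n\<in>I. \<forall>n'\<in>I. agree (xs n) (xs n') N)" for N I
  have step: "\<exists>J\<subseteq>I. P N J" if inf: "infinite I" for N and I :: "nat set"
  proof -
    define h where "h n = map (xs n) [- int N..int N]" for n
    have "h ` I \<subseteq> {w. set w \<subseteq> A \<and> length w = length [- int N..int N]}"
      using A(2) by (auto simp: h_def)
    then have "finite (h ` I)"
      using finite_lists_length_eq[OF A(1)] by (rule finite_subset)
    then obtain n0 where n0: "n0 \<in> I" "infinite {n \<in> I. h n = h n0}"
      using pigeonhole_infinite[OF inf, of h] by blast
    have agr: "agree (xs n) (xs n') N" if "h n = h n'" for n n'
      using that unfolding agree_def h_def map_eq_conv by (simp add: abs_le_iff)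
    have "P N {n \<in> I. h n = h n0}"
      unfolding P_def using n0(2) by (auto intro: agr)
    then show ?thesis by (intro exI[of _ "{n \<in> I. h n = h n0}"] conjI) auto
  qed
  \<comment> \<open>Diagonal argument: nested infinite index sets, the points of the
    \<open>N\<close>-th one agreeing on \<open>[-N, N]\<close>. The limit reads coordinate
    \<open>i\<close> from any member of the set number \<open>\<bar>i\<bar>\<close>.\<close>
  have "\<exists>I. \<forall>n. P n (I n) \<and> I (Suc n) \<subseteq> I n"
  proof (rule dependent_nat_choice)
    show "\<exists>I. P 0 I" using step[OF infinite_UNIV_nat] by iprover
    show "\<exists>J. P (Suc n) J \<and> J \<subseteq> I" if "P n I" for I n
    proof -
      have "infinite I" using that by (simp add: P_def)
      from step[OF this] show ?thesis by iprover
    qed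
  qed
  then obtain I where I: "\<And>n. P n (I n)" "\<And>n. I (Suc n) \<subseteq> I n" by auto
  have dec: "I n \<subseteq> I m" if "m \<le> n" for m n
    by (rule lift_Suc_antimono_le[of I]) (use I(2) that in auto)
  have ne: "\<exists>n. n \<in> I m" for m
    using I(1)[of m] infinite_imp_nonempty[of "I m"] unfolding P_def by auto
  define x where "x i = xs (SOME n. n \<in> I (nat \<bar>i\<bar>)) i" for i
  have "\<exists>n\<ge>k. agree x (xs n) N" for N k
  proof -
    obtain n where n: "n \<in> I N" "n \<ge> k"
      using I(1)[of N] unfolding P_def infinite_nat_iff_unbounded_le by blast
    have "x i = xs n i" if i: "\<bar>i\<bar> \<le> int N" for i
    proof -
      let ?m = "nat \<bar>i\<bar>"
      have "n \<in> I ?m" using n(1) dec[of ?m N] i by (meson nat_le_iff subsetD)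
      moreover have "(SOME n. n \<in> I ?m) \<in> I ?m" using ne by (rule someI_ex)
      ultimately have "agree (xs (SOME n. n \<in> I ?m)) (xs n) ?m"
        using I(1)[of ?m] unfolding P_def by blast
      then show ?thesis unfolding x_def by (rule agreeD) simp
    qed
    then show ?thesis using n(2) by (auto simp: agree_def)
  qed
  then show ?thesis by (rule that)
qed

lemma cluster_point_in:
  fixes xs :: "nat \<Rightarrow> int \<Rightarrow> 'a"
  assumes "subshift X" "finite A" "\<And>x. x \<in> X \<Longrightarrow> range x \<subseteq> A" "\<And>n. xs n \<in> X"
  obtains x where "x \<in> X" "\<And>N k. \<exists>n\<ge>k. agree x (xs n) N"
proof -
  obtain x where x: "\<And>N k. \<exists>n\<ge>k. agree x (xs n) N"
    using cluster_point[OF assms(2), of xs] assms(3)[OF assms(4)] by (metis rangeI subsetD)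
  have "x \<in> X"
    by (rule subshift_closedD[OF assms(1)]) (use x assms(4) in blast)
  then show ?thesis using x by (rule that)
qed

text \<open>Curtis-Hedlund-Lyndon: continuity only gives a radius depending on the point, but if no
  radius served all points, a cluster point of counterexamples would violate continuity there.
  Commutation with the shift carries the radius from coordinate 0 to every other.\<close>

lemma factor_map_local:
  assumes X: "subshift X" and A: "finite A" "\<And>x. x \<in> X \<Longrightarrow> range x \<subseteq> A"
    and f: "factor_map f X Y"
  obtains R :: nat where
    "\<And>x y i. x \<in> X \<Longrightarrow> y \<in> X \<Longrightarrow> (\<And>j. \<bar>j - i\<bar> \<le> int R \<Longrightarrow> x j = y j) \<Longrightarrow> f x i = f y i"
proof -
  have "\<exists>R. \<forall>x\<in>X. \<forall>y\<in>X. agree x y R \<longrightarrow> f x 0 = f y 0"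
  proof (rule ccontr)
    assume "\<not> ?thesis"
    then have "\<forall>R. \<exists>x y. x \<in> X \<and> y \<in> X \<and> agree x y R \<and> f x 0 \<noteq> f y 0" by blast
    then obtain xs ys where xy: "\<And>R. xs R \<in> X" "\<And>R. ys R \<in> X" "\<And>R. agree (xs R) (ys R) R"
      "\<And>R. f (xs R) 0 \<noteq> f (ys R) 0" by metis
    obtain x where x: "x \<in> X" "\<And>N k. \<exists>n\<ge>k. agree x (xs n) N"
      using cluster_point_in[OF X A, of xs] xy(1) by blast
    obtain M where M: "\<And>y. y \<in> X \<Longrightarrow> agree x y M \<Longrightarrow> agree (f x) (f y) 0"
      using f x(1) unfolding factor_map_def by blast
    obtain n where n: "n \<ge> M" "agree x (xs n) M" using x(2) by blast
    have "agree x (ys n) M" using n xy(3)[of n] by (auto simp: agree_def)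
    then have "f x 0 = f (ys n) 0" "f x 0 = f (xs n) 0"
      using M n xy(1,2) by (auto simp: agree_def)
    then show False using xy(4)[of n] by simp
  qed
  then obtain R where R: "\<And>x y. x \<in> X \<Longrightarrow> y \<in> X \<Longrightarrow> agree x y R \<Longrightarrow> f x 0 = f y 0" by blast
  show ?thesis
  proof (rule that[of R])
    fix x y i assume "x \<in> X" "y \<in> X" and j: "\<And>j. \<bar>j - i\<bar> \<le> int R \<Longrightarrow> x j = y j"
    then have "f (tr i x) 0 = f (tr i y) 0"
      by (intro R subshift_tr[OF X]) (auto simp: agree_def)
    then show "f x i = f y i"
      using factor_map_tr[OF f X, of x i] factor_map_tr[OF f X, of y i] \<open>x \<in> X\<close> \<open>y \<in> X\<close> by simp
  qed
qed

section \<open>Shifts of finite type\<close>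

lemma occurs_tr [simp]: "occurs w (tr k x) \<longleftrightarrow> occurs w x"
proof -
  have "\<exists>i. word x i (length w) = w \<Longrightarrow> \<exists>i. word x (i + k) (length w) = w"
    by (metis diff_add_cancel)
  then show ?thesis by (auto simp: occurs_def)
qed

lemma sft_tr: "sft_on A T \<Longrightarrow> x \<in> T \<Longrightarrow> tr k x \<in> T"
  unfolding sft_on_def by (auto simp: image_subset_iff)

lemma sft_subshift:
  assumes "sft_on A T"
  shows "subshift T"
  unfolding subshift_def shift_closed_def shift_eq_tr
proof (intro conjI allI impI)
  show "tr 1 ` T = T"
  proof (intro equalityI subsetI)
    fix x assume "x \<in> T"
    then have "tr (-1) x \<in> T" by (rule sft_tr[OF assms])
    then show "x \<in> tr 1 ` T" by (rule rev_image_eqI) simp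
  qed (use sft_tr[OF assms] in auto)
next
  fix x assume x: "\<forall>N. \<exists>y\<in>T. agree x y N"
  obtain F where F: "T = {x. range x \<subseteq> A \<and> (\<forall>w\<in>F. \<not> occurs w x)}"
    using assms by (auto simp: sft_on_def)
  have "x i \<in> A" for i
  proof -
    obtain y where "y \<in> T" "agree x y (nat \<bar>i\<bar>)" using x by blast
    then show ?thesis using F agreeD[of x y "nat \<bar>i\<bar>" i] by auto
  qed
  moreover have "\<not> occurs w x" if w: "w \<in> F" for w
  proof
    assume "occurs w x"
    then obtain i where i: "\<And>k. k < length w \<Longrightarrow> x (i + int k) = w ! k"
      by (auto simp: occurs_def word_eq_list_iff)
    obtain y where y: "y \<in> T" "agree x y (nat \<bar>i\<bar> + length w)" using x by blast
    have "y (i + int k) = w ! k" if "k < length w" for k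
      using agreeD[OF y(2), of "i + int k"] i that by auto
    then have "occurs w y" unfolding occurs_def word_eq_list_iff by blast
    then show False using y(1) F w by auto
  qed
  ultimately show "x \<in> T" using F by auto
qed

text \<open>With \<open>M\<close> bounding the lengths of forbidden words, an occurrence in
  \<open>glue x y\<close> that starts before \<open>-M\<close> ends before 0 and lies in
  \<open>x\<close>; any other stays where \<open>glue x y\<close> agrees with
  \<open>y\<close>.\<close>

lemma sft_glue:
  assumes T: "sft_on A T"
  obtains M :: nat where "\<And>x y. x \<in> T \<Longrightarrow> y \<in> T \<Longrightarrow> (\<And>i. - int M \<le> i \<Longrightarrow> i < 0 \<Longrightarrow> x i = y i)
    \<Longrightarrow> glue x y \<in> T"
proof -
  obtain F where F: "finite F" "T = {x. range x \<subseteq> A \<and> (\<forall>w\<in>F. \<not> occurs w x)}"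
    using assms by (auto simp: sft_on_def)
  obtain M where M: "\<And>w. w \<in> F \<Longrightarrow> length w \<le> M"
    using F(1) finite_nat_set_iff_bounded_le[of "length ` F"] by auto
  show ?thesis
  proof (rule that[of M])
    fix x y assume xy: "x \<in> T" "y \<in> T" and eq: "\<And>i. - int M \<le> i \<Longrightarrow> i < 0 \<Longrightarrow> x i = y i"
    have "\<not> occurs w (glue x y)" if w: "w \<in> F" for w
    proof
      assume "occurs w (glue x y)"
      then obtain i where i: "\<And>k. k < length w \<Longrightarrow> glue x y (i + int k) = w ! k"
        by (auto simp: occurs_def word_eq_list_iff)
      have "occurs w x \<or> occurs w y"
      proof (cases "i < - int M")
        case True
        then have "x (i + int k) = w ! k" if "k < length w" for k
          using i[OF that] M[OF w] that by (simp add: glue_def split: if_splits)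
        then show ?thesis unfolding occurs_def word_eq_list_iff by blast
      next
        case False
        then have "y (i + int k) = w ! k" if "k < length w" for k
          using i[OF that] eq[of "i + int k"] by (simp add: glue_def split: if_splits)
        then show ?thesis unfolding occurs_def word_eq_list_iff by blast
      qed
      then show False using xy F w by auto
    qed
    moreover have "range (glue x y) \<subseteq> A" using xy F by (auto simp: glue_def)
    ultimately show "glue x y \<in> T" using F by auto
  qed
qed

section \<open>Finitely many futures in a sofic shift\<close>

definition past_pred :: "((int \<Rightarrow> 'a) \<Rightarrow> bool) \<Rightarrow> bool" where
  "past_pred P \<longleftrightarrow> (\<forall>x y. (\<forall>i<0. x i = y i) \<longrightarrow> P x \<longrightarrow> P y)"

text \<open>A follower set for an arbitrary condition on the past; it specializes to follower sets
  of pasts (\<open>foll\<close>) and of words (\<open>after\<close>). Negative coordinates of its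
  members are free.\<close>

definition fut :: "(int \<Rightarrow> 'a) set \<Rightarrow> ((int \<Rightarrow> 'a) \<Rightarrow> bool) \<Rightarrow> (int \<Rightarrow> 'a) set" where
  "fut X P = {y. \<exists>x\<in>X. P x \<and> (\<forall>i\<ge>0. x i = y i)}"

text \<open>If \<open>X = g(T)\<close>, the condition on the past matters only through the set of central blocks of
  those points of \<open>T\<close> whose image satisfies it.\<close>
lemma sofic_finite_fut:
  assumes "sofic X"
  shows "finite {fut X P |P. past_pred P}"
proof -
  obtain T :: "(int \<Rightarrow> nat) set" and A g where T: "sft_on A T" and g: "factor_map g T X"
    using assms by (auto simp: sofic_def)
  have fA: "finite A" and TA: "\<And>t. t \<in> T \<Longrightarrow> range t \<subseteq> A"
    using T by (auto simp: sft_on_def)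
  obtain R :: nat where R: "\<And>x y i. x \<in> T \<Longrightarrow> y \<in> T \<Longrightarrow>
      (\<And>j. \<bar>j - i\<bar> \<le> int R \<Longrightarrow> x j = y j) \<Longrightarrow> g x i = g y i"
    using factor_map_local[OF sft_subshift[OF T] fA TA g] by blast
  obtain M0 :: nat where M0: "\<And>x y. x \<in> T \<Longrightarrow> y \<in> T \<Longrightarrow>
      (\<And>i. - int M0 \<le> i \<Longrightarrow> i < 0 \<Longrightarrow> x i = y i) \<Longrightarrow> glue x y \<in> T"
    using sft_glue[OF T] by blast
  \<comment> \<open>\<open>M0\<close> lets preimages be glued in \<open>T\<close>; \<open>R\<close>
    makes the image of the glued point agree with \<open>g t'\<close> left of 0 and with
    \<open>g t\<close> from 0 on.\<close>
  define M where "M = max M0 R"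
  define cen where "cen t = map t [- int M..int M]" for t :: "int \<Rightarrow> nat"
  define key where "key P = {cen t |t. t \<in> T \<and> P (g t)}" for P
  have sub: "fut X P \<subseteq> fut X P'" if P: "past_pred P" "past_pred P'" and k: "key P = key P'" for P P'
  proof
    fix y assume "y \<in> fut X P"
    then obtain x where x: "x \<in> X" "P x" "\<And>i. i \<ge> 0 \<Longrightarrow> x i = y i" by (auto simp: fut_def)
    obtain t where t: "t \<in> T" "g t = x" using x(1) g by (auto simp: factor_map_def)
    then have "cen t \<in> key P'" using x(2) k[symmetric] by (auto simp: key_def)
    then obtain t' where t': "t' \<in> T" "P' (g t')" "cen t = cen t'" by (auto simp: key_def)
    have eq: "t i = t' i" if "- int M \<le> i" "i \<le> int M" for i
      using t'(3) that by (auto simp: cen_def)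
    have gT: "glue t' t \<in> T"
      by (rule M0[OF t'(1) t(1)]) (use eq in \<open>auto simp: M_def\<close>)
    have neg: "g (glue t' t) i = g t' i" if "i < 0" for i
      by (rule R[OF gT t'(1)]) (use that eq in \<open>auto simp: glue_def M_def\<close>)
    have pos: "g (glue t' t) i = g t i" if "i \<ge> 0" for i
      by (rule R[OF gT t(1)]) (use that eq in \<open>auto simp: glue_def M_def\<close>)
    have "P' (g (glue t' t))"
      using P(2) t'(2) neg unfolding past_pred_def by metis
    moreover have "g (glue t' t) \<in> X" using g gT by (auto simp: factor_map_def)
    ultimately show "y \<in> fut X P'"
      using pos t(2) x(3) by (auto simp: fut_def)
  qed
  let ?K = "key ` {P. past_pred P}"
  have "finite ?K"
  proof (rule finite_subset)
    show "?K \<subseteq> Pow {w. set w \<subseteq> A \<and> length w = length [- int M..int M]}"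
      using TA by (fastforce simp: key_def cen_def)
    show "finite (Pow {w. set w \<subseteq> A \<and> length w = length [- int M..int M]})"
      using finite_lists_length_eq[OF fA] by simp
  qed
  moreover have "{fut X P |P. past_pred P} \<subseteq>
      (\<lambda>k. fut X (SOME P. past_pred P \<and> key P = k)) ` ?K"
  proof
    fix Q assume "Q \<in> {fut X P |P. past_pred P}"
    then obtain P where P: "past_pred P" "Q = fut X P" by blast
    let ?P = "SOME P'. past_pred P' \<and> key P' = key P"
    have "past_pred ?P \<and> key ?P = key P"
      by (rule someI[of _ P]) (use P in auto)
    then have "Q = fut X ?P" using sub[of P ?P] sub[of ?P P] P by auto
    then show "Q \<in> (\<lambda>k. fut X (SOME P. past_pred P \<and> key P = k)) ` ?K" using P(1) by blast
  qed
  ultimately show ?thesis by (meson finite_surj)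
qed

section \<open>Languages and left-transitive points\<close>

lemma lang_iff:
  assumes "subshift X"
  shows "w \<in> lang X \<longleftrightarrow> (\<exists>x\<in>X. word x i (length w) = w)"
proof
  assume "w \<in> lang X"
  then obtain x j where x: "x \<in> X" "word x j (length w) = w" by (auto simp: lang_def occurs_def)
  then show "\<exists>x\<in>X. word x i (length w) = w"
    using subshift_tr[OF assms x(1), of "j - i"] by (intro bexI[of _ "tr (j - i) x"]) auto
qed (auto simp: lang_def occurs_def)

lemma word_in_lang: "x \<in> X \<Longrightarrow> word x i n \<in> lang X"
  by (auto simp: lang_def occurs_def intro!: bexI[of _ x] exI[of _ i])

lemma irreducibleD: "irreducible X \<Longrightarrow> u \<in> lang X \<Longrightarrow> v \<in> lang X \<Longrightarrow> \<exists>w. u @ w @ v \<in> lang X"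
  by (simp add: irreducible_def)

text \<open>The definition only provides some \<open>i \<le> 0\<close>. Searching for
  \<open>y\<close> shifted by \<open>l\<close>, in a window enlarged by \<open>l\<close>, puts a
  copy of \<open>y\<close> at \<open>i - l \<le> k\<close>.\<close>

lemma left_transitive_far:
  assumes X: "subshift X" and x: "left_transitive X x" and y: "y \<in> X"
  obtains i where "i \<le> k" "\<And>j. \<bar>j\<bar> \<le> int N \<Longrightarrow> x (j + i) = y j"
proof -
  define l where "l = nat \<bar>k\<bar>"
  have "tr (int l) y \<in> X" using subshift_tr[OF X y] .
  then obtain i where i: "i \<le> 0" "agree (\<lambda>j. x (j + i)) (tr (int l) y) (N + l)"
    using x unfolding left_transitive_def by blast
  have "x (j + (i - int l)) = y j" if "\<bar>j\<bar> \<le> int N" for j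
    using agreeD[OF i(2), of "j - int l"] that by (simp add: algebra_simps)
  moreover have "i - int l \<le> k" using i by (simp add: l_def)
  ultimately show ?thesis using that by blast
qed

text \<open>Every window of \<open>X\<close> recurs in \<open>x\<close> arbitrarily far to the left,
  hence also left of \<open>n\<close>, where the two points agree.\<close>

lemma left_transitive_asymptotic:
  assumes X: "subshift X" and x: "left_transitive X x" and y: "y \<in> X"
    and eq: "\<And>i. i < n \<Longrightarrow> y i = x i"
  shows "left_transitive X y"
  unfolding left_transitive_def
proof (intro conjI ballI allI)
  fix z N assume z: "z \<in> X"
  obtain i where i: "i \<le> min 0 (n - int N - 1)" "\<And>j. \<bar>j\<bar> \<le> int N \<Longrightarrow> x (j + i) = z j"
    using left_transitive_far[OF X x z] by blast
  then have "agree (\<lambda>j. y (j + i)) z N" using eq by (auto simp: agree_def)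
  then show "\<exists>i\<le>0. agree (\<lambda>j. y (j + i)) z N" using i(1) by auto
qed (fact y)

lemma left_transitive_tr:
  assumes X: "subshift X" and x: "left_transitive X x"
  shows "left_transitive X (tr k x)"
  unfolding left_transitive_def
proof (intro conjI ballI allI)
  show "tr k x \<in> X" using x subshift_tr[OF X] by (auto simp: left_transitive_def)
  fix z N assume z: "z \<in> X"
  obtain i where i: "i \<le> k" "\<And>j. \<bar>j\<bar> \<le> int N \<Longrightarrow> x (j + i) = z j"
    using left_transitive_far[OF X x z] by blast
  then have "agree (\<lambda>j. tr k x (j + (i - k))) z N" by (auto simp: agree_def)
  then show "\<exists>i\<le>0. agree (\<lambda>j. tr k x (j + i)) z N" using i(1) by (intro exI[of _ "i - k"]) auto
qed

text \<open>Starting from a central block of \<open>x\<close>, each word of the language is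
  prepended at some stage, with a connecting word from irreducibility; a limit of points carrying
  these growing words is left-transitive.\<close>

lemma left_transitive_dense:
  fixes X :: "(int \<Rightarrow> 'a::finite) set"
  assumes X: "subshift X" and irr: "irreducible X" and x: "x \<in> X"
  obtains x' where "left_transitive X x'" "agree x x' N"
proof -
  let ?P = "\<lambda>k u. u \<in> lang X \<and> (k = 0 \<longrightarrow> u = word x (- int N) (2 * N + 1))"
  let ?Q = "\<lambda>k u u'. \<exists>p. u' = p @ u \<and> (from_nat k \<in> lang X \<longrightarrow> (\<exists>g. p = from_nat k @ g))"
  have "\<exists>u. \<forall>k. ?P k (u k) \<and> ?Q k (u k) (u (Suc k))"
  proof (rule dependent_nat_choice)
    show "\<exists>u. ?P 0 u" using word_in_lang[OF x] by blast
    show "\<exists>u'. ?P (Suc k) u' \<and> ?Q k u u'" if h: "?P k u" for u k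
    proof (cases "(from_nat k :: 'a list) \<in> lang X")
      case True
      then obtain g where "from_nat k @ g @ u \<in> lang X"
        using irreducibleD[OF irr True, of u] h by auto
      then show ?thesis
        by (intro exI[of _ "from_nat k @ g @ u"] conjI impI exI[of _ "from_nat k @ g"] exI[of _ g]) auto
    qed (use h in auto)
  qed
  then obtain u :: "nat \<Rightarrow> 'a list" where u: "\<And>k. u k \<in> lang X" "u 0 = word x (- int N) (2 * N + 1)"
    "\<And>k. ?Q k (u k) (u (Suc k))" by blast
  have suf: "\<exists>p. u n = p @ u k" if "k \<le> n" for k n
    using that
  proof (induction n rule: dec_induct)
    case (step n)
    then show ?case using u(3)[of n] by (metis append.assoc)
  qed auto
  \<comment> \<open>\<open>u k\<close> is placed so as to end at coordinate \<open>N\<close>; then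
    each \<open>u k\<close> sits as a suffix inside all later ones, and \<open>u 0\<close> covers
    \<open>[-N, N]\<close>.\<close>
  define e where "e k = int N + 1 - int (length (u k))" for k
  have "\<exists>x\<in>X. word x (e k) (length (u k)) = u k" for k
    using u(1) lang_iff[OF X] by blast
  then have "\<forall>k. \<exists>x. x \<in> X \<and> word x (e k) (length (u k)) = u k" by blast
  from choice[OF this] obtain xs where
    xs: "\<And>k. xs k \<in> X" "\<And>k. word (xs k) (e k) (length (u k)) = u k" by auto
  have xs_nth: "xs n (e k + int j) = u k ! j" if kn: "k \<le> n" and j: "j < length (u k)" for n k j
  proof -
    obtain p where p: "u n = p @ u k" using suf[OF kn] by blast
    have "e k = e n + int (length p)" by (simp add: e_def p)
    moreover have "\<And>i. i < length (u n) \<Longrightarrow> xs n (e n + int i) = u n ! i"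
      using xs(2)[of n] by (simp add: word_eq_list_iff)
    from this[of "length p + j"] have "xs n (e n + int (length p + j)) = u k ! j"
      using j by (simp add: p)
    ultimately show ?thesis by (simp add: algebra_simps)
  qed
  obtain x' where x': "x' \<in> X" "\<And>M k. \<exists>n\<ge>k. agree x' (xs n) M"
    using cluster_point_in[OF X finite subset_UNIV, of xs] xs(1) by blast
  have x'_nth: "x' (e k + int j) = u k ! j" if j: "j < length (u k)" for k j
  proof -
    obtain n where "n \<ge> k" "agree x' (xs n) (nat \<bar>e k + int j\<bar>)" using x'(2) by blast
    then show ?thesis using xs_nth[OF _ j, of n] agreeD[of x' "xs n" _ "e k + int j"] by simp
  qed
  have "left_transitive X x'"
    unfolding left_transitive_def
  proof (intro conjI ballI allI)
    fix y M assume "y \<in> X"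
    define w where "w = word y (- int M) (2 * M + 1)"
    define k where "k = to_nat w"
    have "w \<in> lang X" using word_in_lang[OF \<open>y \<in> X\<close>] by (simp add: w_def)
    then obtain g where g: "u (Suc k) = w @ g @ u k"
      using u(3)[of k] by (auto simp: k_def)
    obtain p where "u k = p @ u 0" using suf[of 0 k] by auto
    then have len: "length (u k) \<ge> 2 * N + 1" using u(2) by simp
    let ?i = "e (Suc k) + int M"
    have lw: "length w = 2 * M + 1" by (simp add: w_def)
    have "x' (j + ?i) = y j" if "\<bar>j\<bar> \<le> int M" for j
    proof -
      have "nat (j + int M) < length w" using that lw by auto
      then have "x' (e (Suc k) + int (nat (j + int M))) = w ! nat (j + int M)"
        using x'_nth[of "nat (j + int M)" "Suc k"] g by (simp add: nth_append)
      also have "\<dots> = y j"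
        unfolding w_def using \<open>nat (j + int M) < length w\<close> lw that by (auto simp: abs_le_iff)
      finally show ?thesis using that by (simp add: algebra_simps abs_le_iff split: if_splits)
    qed
    then have "agree (\<lambda>j. x' (j + ?i)) y M" by (simp add: agree_def)
    moreover have "?i \<le> 0" using len lw by (simp add: e_def g)
    ultimately show "\<exists>i\<le>0. agree (\<lambda>j. x' (j + i)) y M" by blast
  qed (fact x'(1))
  moreover have "agree x x' N"
    unfolding agree_def
  proof (intro allI impI)
    fix i assume i: "\<bar>i\<bar> \<le> int N"
    then show "x i = x' i"
      using x'_nth[of "nat (i + int N)" 0] u(2) by (simp add: e_def abs_le_iff nat_less_iff)
  qed
  ultimately show ?thesis by (rule that)
qed

section \<open>Right-closing maps are right-continuing on left-transitive points\<close>

text \<open>A block read on the past with the least number of compatible states is magic: each of its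
  states can follow every continuation, since a continuation that killed a state would lower the
  number.\<close>
lemma magic_past:
  fixes Z :: "(int \<Rightarrow> 'z) set" and st :: "(int \<Rightarrow> 'z) \<Rightarrow> 's" and ob :: "(int \<Rightarrow> 'z) \<Rightarrow> int \<Rightarrow> 'b"
  assumes fin: "finite (st ` Z)"
    and Z: "\<And>x k. x \<in> Z \<Longrightarrow> tr k x \<in> Z"
    and ob: "\<And>x k. x \<in> Z \<Longrightarrow> ob (tr k x) = tr k (ob x)"
    and det: "\<And>x x' l. x \<in> Z \<Longrightarrow> x' \<in> Z \<Longrightarrow> st x = st x' \<Longrightarrow>
      (\<And>i. 0 \<le> i \<Longrightarrow> i < int l \<Longrightarrow> ob x i = ob x' i) \<Longrightarrow> st (tr (int l) x) = st (tr (int l) x')"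
    and W: "W \<noteq> {}" "\<And>y k. y \<in> W \<Longrightarrow> tr k y \<in> W"
  shows "\<exists>y0\<in>W. \<exists>k0::nat. \<forall>y\<in>W. \<forall>x0\<in>Z. \<forall>l.
    (\<forall>i. - int k0 \<le> i \<longrightarrow> i < 0 \<longrightarrow> y i = y0 i \<and> ob x0 i = y0 i) \<longrightarrow>
    (\<exists>x\<in>Z. st x = st x0 \<and> (\<forall>i. - int k0 \<le> i \<longrightarrow> i < int l \<longrightarrow> ob x i = y i))"
proof -
  define V where "V y k = {st x |x. x \<in> Z \<and> (\<forall>i. - int k \<le> i \<longrightarrow> i < 0 \<longrightarrow> ob x i = y i)}"
    for y and k :: nat
  have finV: "finite (V y k)" for y k
    by (rule finite_subset[OF _ fin]) (auto simp: V_def)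
  obtain w where w: "w \<in> W" using W(1) by blast
  define m where "m = (\<lambda>p. card (V (fst p) (snd p)))"
  have "\<exists>p. fst p \<in> W \<and> (\<forall>q. fst q \<in> W \<longrightarrow> m p \<le> m q)"
    by (rule ex_has_least_nat[of "\<lambda>p. fst p \<in> W" "(w, 0)"]) (simp add: w)
  then obtain p where p: "fst p \<in> W" "\<And>q. fst q \<in> W \<Longrightarrow> m p \<le> m q" by blast
  define y0 k0 where "y0 = fst p" and "k0 = snd p"
  have y0: "y0 \<in> W" using p(1) by (simp add: y0_def)
  have least: "card (V y0 k0) \<le> card (V y k)" if "y \<in> W" for y k
    using p(2)[of "(y, k)"] that by (simp add: m_def y0_def k0_def)
  show ?thesis
  proof (intro bexI[of _ y0] exI[of _ k0] ballI allI impI y0)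
    fix y x0 l
    assume y: "y \<in> W" and x0: "x0 \<in> Z"
      and *: "\<forall>i. - int k0 \<le> i \<longrightarrow> i < 0 \<longrightarrow> y i = y0 i \<and> ob x0 i = y0 i"
    have yy0: "y i = y0 i" and x0y: "ob x0 i = y0 i" if "- int k0 \<le> i" "i < 0" for i
      using * that by auto
    define G where "G x \<longleftrightarrow> x \<in> Z \<and> (\<forall>i. - int k0 \<le> i \<longrightarrow> i < int l \<longrightarrow> ob x i = y i)" for x
    define A where "A = {st x |x. G x}"
    have A: "A \<subseteq> V y0 k0" using yy0 by (auto simp: A_def V_def G_def)
    \<comment> \<open>\<open>h\<close> advances a state by the outputs \<open>y[0, l-1]\<close>,
      well defined by \<open>det\<close>. It covers all states compatible with the longer block,
      whose number is at least the minimum; so \<open>A\<close> cannot be smaller than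
      \<open>V y0 k0\<close>.\<close>
    define h where "h s = st (tr (int l) (SOME x. G x \<and> st x = s))" for s
    have "V (tr (int l) y) (k0 + l) \<subseteq> h ` A"
    proof
      fix s assume "s \<in> V (tr (int l) y) (k0 + l)"
      then obtain x' where x': "x' \<in> Z" "s = st x'"
        "\<And>i. - int (k0 + l) \<le> i \<Longrightarrow> i < 0 \<Longrightarrow> ob x' i = y (i + int l)"
        by (auto simp: V_def)
      define x where "x = tr (- int l) x'"
      have xZ: "x \<in> Z" using Z[OF x'(1)] by (simp add: x_def)
      have "ob x i = y i" if "- int k0 \<le> i" "i < int l" for i
        using x'(3)[of "i - int l"] ob[OF x'(1)] that by (simp add: x_def)
      then have Gx: "G x" using xZ by (simp add: G_def)
      define x'' where "x'' = (SOME z. G z \<and> st z = st x)"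
      have x'': "G x'' \<and> st x'' = st x" unfolding x''_def by (rule someI[of _ x]) (simp add: Gx)
      have "st (tr (int l) x'') = st (tr (int l) x)"
        by (rule det) (use x'' Gx in \<open>auto simp: G_def\<close>)
      then have "h (st x) = s" by (simp add: h_def x''_def x'(2) x_def)
      moreover have "st x \<in> A" using Gx by (auto simp: A_def)
      ultimately show "s \<in> h ` A" by blast
    qed
    then have "card (V (tr (int l) y) (k0 + l)) \<le> card A"
      using surj_card_le[OF finite_subset[OF A finV]] by blast
    then have "card (V y0 k0) \<le> card A" using least[OF W(2)[OF y], of "int l" "k0 + l"] by simp
    then have "A = V y0 k0" using card_seteq[OF finV A] by simp
    moreover have "st x0 \<in> V y0 k0" using x0 x0y by (auto simp: V_def)
    ultimately have "st x0 \<in> A" by simp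
    then show "\<exists>x\<in>Z. st x = st x0 \<and> (\<forall>i. - int k0 \<le> i \<longrightarrow> i < int l \<longrightarrow> ob x i = y i)"
      by (auto simp: A_def G_def)
  qed
qed

text \<open>The window of \<open>f\<close> looks only to the left. Any block code takes this form
  after composition with a shift, and then the outputs at negative coordinates depend on the past
  alone, as gluing at 0 requires.\<close>

locale closing_code =
  fixes X :: "(int \<Rightarrow> 'a::finite) set" and Y :: "(int \<Rightarrow> 'b::finite) set"
    and f :: "(int \<Rightarrow> 'a) \<Rightarrow> int \<Rightarrow> 'b" and r :: nat
  assumes sofic_X: "sofic X"
    and irr: "irreducible X"
    and f: "factor_map f X Y"
    and Y: "subshift Y"
    and local: "\<And>x y i. x \<in> X \<Longrightarrow> y \<in> X \<Longrightarrow> (\<And>j. i - int r \<le> j \<Longrightarrow> j \<le> i \<Longrightarrow> x j = y j) \<Longrightarrow> f x i = f y i"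
    and rc: "right_closing_ae f X"
begin

lemma X: "subshift X"
  using sofic_X by (simp add: sofic_def)

definition foll :: "(int \<Rightarrow> 'a) \<Rightarrow> (int \<Rightarrow> 'a) set" where
  "foll x = {y. glue x y \<in> X}"

lemma finite_foll: "finite (range foll)"
proof (rule finite_subset[OF _ sofic_finite_fut[OF sofic_X]])
  have "foll x = fut X (\<lambda>x'. \<forall>i<0. x' i = x i)" for x
  proof (intro equalityI subsetI)
    fix y assume "y \<in> foll x"
    then show "y \<in> fut X (\<lambda>x'. \<forall>i<0. x' i = x i)"
      by (auto simp: foll_def fut_def intro!: bexI[of _ "glue x y"])
  next
    fix y assume "y \<in> fut X (\<lambda>x'. \<forall>i<0. x' i = x i)"
    then obtain x' where x': "x' \<in> X" "\<forall>i<0. x' i = x i" "\<forall>i\<ge>0. x' i = y i"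
      by (auto simp: fut_def)
    have "x' = glue x y" using x' by (auto simp: glue_def)
    then show "y \<in> foll x" using x'(1) by (simp add: foll_def)
  qed
  moreover have "past_pred (\<lambda>x'. \<forall>i<0. x' i = x i)" for x :: "int \<Rightarrow> 'a"
    by (simp add: past_pred_def)
  ultimately show "range foll \<subseteq> {fut X P |P. past_pred P}" by blast
qed

lemma foll_self: "x \<in> X \<Longrightarrow> x \<in> foll x"
  by (simp add: foll_def)

lemma foll_cong:
  assumes "\<And>i. i < 0 \<Longrightarrow> x i = x' i"
  shows "foll x = foll x'"
proof -
  have "glue x y = glue x' y" for y using assms by (auto simp: glue_def)
  then show ?thesis by (simp add: foll_def)
qed

text \<open>The next follower set is determined by the present one and the symbol read, so follower
  sets can be part of a deterministic state. The values at negative coordinates are immaterial for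
  membership in \<open>foll x\<close>.\<close>

lemma foll_tr: "foll (tr 1 x) = {y. (\<lambda>i. if i \<le> 0 then x 0 else y (i - 1)) \<in> foll x}"
proof -
  have 1: "tr (-1) (glue (tr 1 x) y) = glue x (\<lambda>i. if i \<le> 0 then x 0 else y (i - 1))" for y
    by (auto simp: glue_def)
  have "glue (tr 1 x) y \<in> X \<longleftrightarrow> tr (-1) (glue (tr 1 x) y) \<in> X" for y
    using subshift_tr[OF X, of "glue (tr 1 x) y" "-1"]
      subshift_tr[OF X, of "tr (-1) (glue (tr 1 x) y)" 1] by auto
  then show ?thesis unfolding foll_def 1 by blast
qed

lemma left_transitive_in: "left_transitive X x \<Longrightarrow> x \<in> X"
  by (simp add: left_transitive_def)

text \<open>If no delay worked, there would be counterexamples for all \<open>D\<close> with one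
  common follower set and common last \<open>r\<close> symbols. Their futures can be attached to one
  left-transitive past \<open>l\<close> without changing the outputs from 0 on, so the limits are
  left-transitive, have equal images and still differ at 0, against \<open>rc\<close>.\<close>

lemma delay:
  obtains D :: nat where "\<And>x x'. left_transitive X x \<Longrightarrow> left_transitive X x' \<Longrightarrow> foll x = foll x' \<Longrightarrow>
    (\<And>i. - int r \<le> i \<Longrightarrow> i < 0 \<Longrightarrow> x i = x' i) \<Longrightarrow>
    (\<And>i. 0 \<le> i \<Longrightarrow> i \<le> int D \<Longrightarrow> f x i = f x' i) \<Longrightarrow> x 0 = x' 0"
proof -
  define bad where "bad D x x' \<longleftrightarrow> left_transitive X x \<and> left_transitive X x' \<and> foll x = foll x' \<and>
    (\<forall>i. - int r \<le> i \<longrightarrow> i < 0 \<longrightarrow> x i = x' i) \<and> (\<forall>i. 0 \<le> i \<longrightarrow> i \<le> int D \<longrightarrow> f x i = f x' i) \<and>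
    x 0 \<noteq> x' 0" for D x x'
  have "\<exists>D. \<forall>x x'. \<not> bad D x x'"
  proof (rule ccontr)
    assume "\<not> ?thesis"
    then have "\<forall>D. \<exists>p. bad D (fst p) (snd p)" by simp
    from choice[OF this] obtain ps where ps: "\<And>D. bad D (fst (ps D)) (snd (ps D))" by auto
    define xs xs' where "xs D = fst (ps D)" and "xs' D = snd (ps D)" for D
    have bad: "bad D (xs D) (xs' D)" for D using ps by (simp add: xs_def xs'_def)
    define dat where "dat D = (foll (xs D), map (xs D) [- int r..-1])" for D
    have "range dat \<subseteq> range foll \<times> {w. set w \<subseteq> UNIV \<and> length w = length [- int r..-1]}"
      by (auto simp: dat_def)
    then have "finite (range dat)"
      by (rule finite_subset) (intro finite_cartesian_product finite_foll finite_lists_length_eq finite)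
    then obtain D0 where D0: "infinite {D \<in> UNIV. dat D = dat D0}"
      using pigeonhole_infinite[OF infinite_UNIV_nat, of dat] by blast
    have "\<forall>n. \<exists>D. D \<ge> n \<and> dat D = dat D0"
      using D0 unfolding infinite_nat_iff_unbounded_le by auto
    from choice[OF this] obtain s where s: "\<And>n. s n \<ge> n" "\<And>n. dat (s n) = dat D0" by auto
    define l where "l = xs D0"
    define zs where "zs n = glue l (xs (s n))" for n
    define zs' where "zs' n = glue l (xs' (s n))" for n
    have LT: "left_transitive X (xs n)" "left_transitive X (xs' n)" for n
      using bad[of n] by (simp_all add: bad_def)
    have xsX: "xs n \<in> X" "xs' n \<in> X" for n using LT left_transitive_in by auto
    have foll_eq: "foll (xs (s n)) = foll l" "foll (xs' (s n)) = foll l" for n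
      using s(2)[of n] bad[of "s n"] by (auto simp: dat_def l_def bad_def)
    have "xs (s n) \<in> foll l" "xs' (s n) \<in> foll l" for n
      using foll_self[OF xsX(1), of "s n"] foll_self[OF xsX(2), of "s n"] foll_eq[of n] by simp_all
    then have zsX: "zs n \<in> X" "zs' n \<in> X" for n
      by (simp_all add: foll_def zs_def zs'_def)
    have l_eq: "l i = xs (s n) i" "l i = xs' (s n) i" if "- int r \<le> i" "i < 0" for n i
    proof -
      show "l i = xs (s n) i"
        using s(2)[of n] that unfolding dat_def prod.inject map_eq_conv l_def by auto
      then show "l i = xs' (s n) i" using bad[of "s n"] that by (auto simp: bad_def)
    qed
    have f_eq: "f (zs n) i = f (zs' n) i" if i: "i \<le> int n" for n i
    proof (cases "i < 0")
      case True
      show ?thesis by (rule local[OF zsX]) (use True in \<open>simp add: zs_def zs'_def\<close>)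
    next
      case False
      have "f (zs n) i = f (xs (s n)) i"
        by (rule local[OF zsX(1) xsX(1)])
          (use False l_eq in \<open>auto simp: zs_def glue_def\<close>)
      moreover have "f (zs' n) i = f (xs' (s n)) i"
        by (rule local[OF zsX(2) xsX(2)])
          (use False l_eq in \<open>auto simp: zs'_def glue_def\<close>)
      moreover have "f (xs (s n)) i = f (xs' (s n)) i"
        using bad[of "s n"] False i s(1)[of n] by (simp add: bad_def)
      ultimately show ?thesis by simp
    qed
    \<comment> \<open>A cluster point of the pairs makes both sequences converge along the same
      indices.\<close>
    obtain p where p: "\<And>N k. \<exists>n\<ge>k. agree p (\<lambda>i. (zs n i, zs' n i)) N"
      using cluster_point[of UNIV "\<lambda>n i. (zs n i, zs' n i)"] by auto
    define z z' where "z = (\<lambda>i. fst (p i))" and "z' = (\<lambda>i. snd (p i))"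
    have ag: "\<exists>n\<ge>k. agree z (zs n) N \<and> agree z' (zs' n) N" for N k
      using p[of k N] by (auto simp: agree_def z_def z'_def)
    have zX: "z \<in> X" "z' \<in> X"
      by (rule subshift_closedD[OF X]; use ag[of 0] zsX in blast)+
    have neg: "z i = l i" "z' i = l i" if i: "i < 0" for i
    proof -
      obtain n where "agree z (zs n) (nat \<bar>i\<bar>)" "agree z' (zs' n) (nat \<bar>i\<bar>)"
        using ag[of 0 "nat \<bar>i\<bar>"] by auto
      then show "z i = l i" "z' i = l i"
        using i agreeD[of z "zs n" "nat \<bar>i\<bar>" i] agreeD[of z' "zs' n" "nat \<bar>i\<bar>" i]
        by (simp_all add: zs_def zs'_def)
    qed
    have "f z i = f z' i" for i
    proof -
      obtain n where n: "n \<ge> nat \<bar>i\<bar>" "agree z (zs n) (nat \<bar>i\<bar> + r)" "agree z' (zs' n) (nat \<bar>i\<bar> + r)"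
        using ag[of "nat \<bar>i\<bar>" "nat \<bar>i\<bar> + r"] by auto
      have "f z i = f (zs n) i"
        by (rule local[OF zX(1) zsX(1)]) (rule agreeD[OF n(2)], linarith)
      moreover have "f z' i = f (zs' n) i"
        by (rule local[OF zX(2) zsX(2)]) (rule agreeD[OF n(3)], linarith)
      ultimately show ?thesis using f_eq[of i n] n(1) by simp
    qed
    then have "f z = f z'" by blast
    moreover have "left_transitive X z" "left_transitive X z'"
      using left_transitive_asymptotic[OF X, of l z 0] left_transitive_asymptotic[OF X, of l z' 0]
        neg zX LT(1)[of D0] by (simp_all add: l_def)
    moreover have "left_asymptotic z z'"
      unfolding left_asymptotic_def by (rule exI[of _ "-1"]) (simp add: neg)
    ultimately have "z = z'" using rc zX unfolding right_closing_ae_def by blast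
    moreover obtain n where "agree z (zs n) 0" "agree z' (zs' n) 0" using ag[of 0 0] by auto
    ultimately have "xs (s n) 0 = xs' (s n) 0"
      using agreeD[of z "zs n" 0 0] agreeD[of z' "zs' n" 0 0] by (simp add: zs_def zs'_def)
    then show False using bad[of "s n"] by (simp add: bad_def)
  qed
  then show ?thesis using that unfolding bad_def by blast
qed

text \<open>The state of a left-transitive point records its follower set, its last \<open>r\<close> symbols and its
  next \<open>D\<close> outputs, \<open>D\<close> being the delay; reading one more output then determines the next
  symbol, so that \<open>f\<close> becomes right-resolving on states.\<close>
lemma right_continuing_left_transitive:
  obtains D :: nat where "\<And>x y. left_transitive X x \<Longrightarrow> y \<in> Y \<Longrightarrow>
    (\<And>i. i < int D \<Longrightarrow> y i = f x i) \<Longrightarrow> \<exists>x'\<in>X. (\<forall>i<0. x' i = x i) \<and> f x' = y"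
proof -
  obtain D :: nat where D: "\<And>x x'. left_transitive X x \<Longrightarrow> left_transitive X x' \<Longrightarrow> foll x = foll x' \<Longrightarrow>
    (\<And>i. - int r \<le> i \<Longrightarrow> i < 0 \<Longrightarrow> x i = x' i) \<Longrightarrow>
    (\<And>i. 0 \<le> i \<Longrightarrow> i \<le> int D \<Longrightarrow> f x i = f x' i) \<Longrightarrow> x 0 = x' 0"
    using delay by blast
  define st where "st x = (foll x, map x [- int r..-1], map (f x) [0..int D - 1])" for x
  have st_iff: "st x = st x' \<longleftrightarrow> foll x = foll x' \<and>
      (\<forall>i. - int r \<le> i \<longrightarrow> i < 0 \<longrightarrow> x i = x' i) \<and> (\<forall>i. 0 \<le> i \<longrightarrow> i < int D \<longrightarrow> f x i = f x' i)" for x x'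
    unfolding st_def prod.inject map_eq_conv by auto
  define Z where "Z = {x. left_transitive X x}"
  have ZX: "x \<in> X" if "x \<in> Z" for x using that left_transitive_in by (simp add: Z_def)
  have Ztr: "tr k x \<in> Z" if "x \<in> Z" for x k using that left_transitive_tr[OF X] by (simp add: Z_def)
  have ftr: "f (tr k x) = tr k (f x)" if "x \<in> X" for x k by (rule factor_map_tr[OF f X that])
  have step: "x 0 = x' 0 \<and> st (tr 1 x) = st (tr 1 x')"
    if x: "x \<in> Z" "x' \<in> Z" and st: "st x = st x'" and fD: "f x (int D) = f x' (int D)" for x x'
  proof
    have f_eq: "f x i = f x' i" if "0 \<le> i" "i \<le> int D" for i
      using st fD that by (cases "i = int D") (auto simp: st_iff)
    show x0: "x 0 = x' 0"
      by (rule D) (use x st f_eq in \<open>auto simp: st_iff Z_def\<close>)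
    have "x i = x' i" if "- int r \<le> i" "i < 1" for i
      using st x0 that by (cases "i = 0") (auto simp: st_iff)
    moreover have "foll x = foll x'" using st by (simp add: st_iff)
    then have "foll (tr 1 x) = foll (tr 1 x')" by (simp only: foll_tr x0)
    ultimately show "st (tr 1 x) = st (tr 1 x')"
      unfolding st_iff using f_eq ftr[OF ZX] x by auto
  qed
  have steps: "st (tr (int k) x) = st (tr (int k) x') \<and> (\<forall>i. 0 \<le> i \<longrightarrow> i < int k \<longrightarrow> x i = x' i)"
    if x: "x \<in> Z" "x' \<in> Z" and st: "st x = st x'"
      and fD: "\<And>i. int D \<le> i \<Longrightarrow> i < int D + int k \<Longrightarrow> f x i = f x' i" for x x' k
  proof -
    define E where "E k \<longleftrightarrow> st (tr (int k) x) = st (tr (int k) x') \<and>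
      (\<forall>i. 0 \<le> i \<longrightarrow> i < int k \<longrightarrow> x i = x' i)" for k
    have "E k"
      using fD
    proof (induction k)
      case 0
      then show ?case using st by (simp add: E_def)
    next
      case (Suc k)
      then have "E k" by auto
      then have IH: "st (tr (int k) x) = st (tr (int k) x')" "\<And>i. 0 \<le> i \<Longrightarrow> i < int k \<Longrightarrow> x i = x' i"
        by (auto simp: E_def)
      have "f (tr (int k) x) (int D) = f (tr (int k) x') (int D)"
        using Suc.prems[of "int D + int k"] ftr[OF ZX] x by simp
      from step[OF Ztr[OF x(1)] Ztr[OF x(2)] IH(1) this]
      have new: "x (int k) = x' (int k)" "st (tr (1 + int k) x) = st (tr (1 + int k) x')" by simp_all
      have "x i = x' i" if "0 \<le> i" "i < int (Suc k)" for i
        using IH(2)[of i] new(1) that by (cases "i = int k") auto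
      then show ?case using new(2) by (simp add: E_def)
    qed
    then show ?thesis by (simp add: E_def)
  qed
  \<comment> \<open>The state already stores the outputs before \<open>D\<close>, so the output that
    drives the next transition is the one at \<open>D\<close>.\<close>
  define ob where "ob x = tr (int D) (f x)" for x
  have fin: "finite (st ` Z)"
  proof (rule finite_subset)
    show "st ` Z \<subseteq> range foll \<times> {w. set w \<subseteq> UNIV \<and> length w = length [- int r..-1]} \<times>
        {w. set w \<subseteq> UNIV \<and> length w = length [0..int D - 1]}"
      by (auto simp: st_def)
  qed (intro finite_cartesian_product finite_foll finite_lists_length_eq finite)
  have "Y \<noteq> {}"
    using irr f by (auto simp: irreducible_def factor_map_def)
  have "\<exists>y0\<in>Y. \<exists>k0::nat. \<forall>y\<in>Y. \<forall>x0\<in>Z. \<forall>l.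
    (\<forall>i. - int k0 \<le> i \<longrightarrow> i < 0 \<longrightarrow> y i = y0 i \<and> ob x0 i = y0 i) \<longrightarrow>
    (\<exists>x\<in>Z. st x = st x0 \<and> (\<forall>i. - int k0 \<le> i \<longrightarrow> i < int l \<longrightarrow> ob x i = y i))"
  proof (rule magic_past[OF fin Ztr _ _ \<open>Y \<noteq> {}\<close> subshift_tr[OF Y]])
    show "ob (tr k x) = tr k (ob x)" if "x \<in> Z" for x k
      unfolding ob_def ftr[OF ZX[OF that]] tr_tr by (simp add: add.commute)
    fix x x' l
    assume x: "x \<in> Z" "x' \<in> Z" "st x = st x'" and o: "\<And>i. 0 \<le> i \<Longrightarrow> i < int l \<Longrightarrow> ob x i = ob x' i"
    have "f x i = f x' i" if "int D \<le> i" "i < int D + int l" for i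
      using o[of "i - int D"] that by (simp add: ob_def)
    then show "st (tr (int l) x) = st (tr (int l) x')" using steps[OF x] by blast
  qed
  then obtain y0 and k0 :: nat where y0: "y0 \<in> Y" and magic0: "\<forall>y\<in>Y. \<forall>x0\<in>Z. \<forall>l.
    (\<forall>i. - int k0 \<le> i \<longrightarrow> i < 0 \<longrightarrow> y i = y0 i \<and> ob x0 i = y0 i) \<longrightarrow>
    (\<exists>x\<in>Z. st x = st x0 \<and> (\<forall>i. - int k0 \<le> i \<longrightarrow> i < int l \<longrightarrow> ob x i = y i))"
    by (elim bexE exE)
  have magic: "\<exists>x\<in>Z. st x = st x0 \<and> (\<forall>i. - int k0 \<le> i \<longrightarrow> i < int l \<longrightarrow> ob x i = y i)"
    if "y \<in> Y" "x0 \<in> Z" "\<And>i. - int k0 \<le> i \<Longrightarrow> i < 0 \<Longrightarrow> y i = y0 i"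
      "\<And>i. - int k0 \<le> i \<Longrightarrow> i < 0 \<Longrightarrow> ob x0 i = y0 i" for y x0 l
    using magic0 that by simp
  \<comment> \<open>Now \<open>ob x0 = y0\<close>, so a window of \<open>x0\<close> produces the
    magic block as delayed output; left-transitivity finds this window in the past of
    \<open>x\<close>.\<close>
  obtain x0 where x0: "x0 \<in> X" "f x0 = tr (- int D) y0"
    using subshift_tr[OF Y y0, of "- int D"] f by (auto simp: factor_map_def)
  show ?thesis
  proof (rule that[of D])
    fix x y assume x: "left_transitive X x" and y: "y \<in> Y" and yx: "\<And>i. i < int D \<Longrightarrow> y i = f x i"
    obtain c where c: "c \<le> 0" "\<And>j. \<bar>j\<bar> \<le> int (D + k0 + r) \<Longrightarrow> x (j + c) = x0 j"
      using left_transitive_far[OF X x x0(1)] by blast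
    define u where "u = tr c x"
    have xX: "x \<in> X" using x by (rule left_transitive_in)
    have uZ: "u \<in> Z" using x by (simp add: u_def Z_def left_transitive_tr[OF X])
    have uX: "u \<in> X" using uZ by (rule ZX)
    have fu: "f u i = f x (i + c)" for i by (simp add: u_def ftr[OF xX])
    have ob_u: "ob u i = y0 i" if i: "- int k0 \<le> i" "i < 0" for i
    proof -
      have "f u (i + int D) = f x0 (i + int D)"
        by (rule local[OF uX x0(1)]) (use c(2) i in \<open>auto simp: u_def\<close>)
      then show ?thesis by (simp add: ob_def x0(2))
    qed
    \<comment> \<open>From the magic block at \<open>c\<close> on, \<open>y\<close> can be followed
      for any finite length. The lift starts in the state of \<open>u\<close>, and as
      \<open>y\<close> and \<open>f x\<close> agree below \<open>D\<close>, resolving forces it to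
      equal \<open>u\<close> left of \<open>-c\<close>, which is coordinate 0 of
      \<open>x\<close>.\<close>
    have ex: "\<exists>v\<in>X. (\<forall>i< -c. v i = u i) \<and> (\<forall>i<int D + int l. f v i = y (i + c))"
      if l: "int l \<ge> -c" for l
    proof -
      have yc: "tr (int D + c) y i = y0 i" if "- int k0 \<le> i" "i < 0" for i
        using ob_u[OF that] yx[of "i + int D + c"] c(1) that by (simp add: ob_def fu algebra_simps)
      obtain v0 where v0: "v0 \<in> Z" "st v0 = st u"
        "\<And>i. - int k0 \<le> i \<Longrightarrow> i < int l \<Longrightarrow> ob v0 i = tr (int D + c) y i"
        using magic[OF subshift_tr[OF Y y] uZ yc ob_u, of l] by blast
      define v where "v = glue u v0"
      have "v0 \<in> foll u" using foll_self[OF ZX[OF v0(1)]] v0(2) by (simp add: st_iff)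
      then have vX: "v \<in> X" by (simp add: v_def foll_def)
      have v_neg: "f v i = f u i" if "i < 0" for i
        by (rule local[OF vX uX]) (use that in \<open>simp add: v_def\<close>)
      have v_pos: "f v i = f v0 i" if "i \<ge> 0" for i
        by (rule local[OF vX ZX[OF v0(1)]])
          (use that v0(2) in \<open>auto simp: v_def glue_def st_iff\<close>)
      have fv: "f v i = y (i + c)" if i: "i < int D + int l" for i
      proof (cases "i < int D")
        case True
        then have "f v i = f u i" using v_neg v_pos[of i] v0(2) by (cases "i < 0") (auto simp: st_iff)
        then show ?thesis using fu[of i] yx[of "i + c"] True c(1) by simp
      next
        case False
        then show ?thesis using v_pos[of i] v0(3)[of "i - int D"] i by (simp add: ob_def algebra_simps)
      qed
      have "st v = st u"
        unfolding st_iff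
      proof (intro conjI allI impI)
        show "foll v = foll u" by (rule foll_cong) (simp add: v_def)
        show "v i = u i" if "i < 0" for i using that by (simp add: v_def)
        show "f v i = f u i" if "0 \<le> i" "i < int D" for i
          using v_pos[of i] v0(2) that by (simp add: st_iff)
      qed
      moreover have "v \<in> Z"
        unfolding Z_def using uZ left_transitive_asymptotic[OF X _ vX, of u 0] by (simp add: v_def Z_def)
      moreover have "f v i = f u i" if "int D \<le> i" "i < int D + int (nat (-c))" for i
        using fv[of i] that l fu[of i] yx[of "i + c"] c(1) by simp
      ultimately have "v i = u i" if "0 \<le> i" "i < int (nat (-c))" for i
        using steps[of v u "nat (-c)"] uZ that by blast
      then have "v i = u i" if "i < -c" for i
        using that c(1) by (cases "i < 0") (auto simp: v_def)
      then show ?thesis using vX fv by blast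
    qed
    have "\<forall>l. \<exists>w. w \<in> X \<and> (\<forall>i<0. w i = x i) \<and> (\<forall>i<int l. f w i = y i)"
    proof
      fix l
      have "int (l + nat (-c)) \<ge> -c" by simp
      then obtain v where v: "v \<in> X" "\<And>i. i < -c \<Longrightarrow> v i = u i"
        "\<And>i. i < int D + int (l + nat (-c)) \<Longrightarrow> f v i = y (i + c)"
        using ex by blast
      have "tr (-c) v \<in> X" using subshift_tr[OF X v(1)] .
      moreover have "\<forall>i<0. tr (-c) v i = x i" using v(2) by (simp add: u_def)
      moreover have "\<forall>i<int l. f (tr (-c) v) i = y i"
        using v(3)[of "_ - c"] c(1) by (simp add: ftr[OF v(1)])
      ultimately show "\<exists>w. w \<in> X \<and> (\<forall>i<0. w i = x i) \<and> (\<forall>i<int l. f w i = y i)" by blast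
    qed
    from choice[OF this] obtain ws where ws: "\<And>l. ws l \<in> X" "\<And>l i. i < 0 \<Longrightarrow> ws l i = x i"
      "\<And>l i. i < int l \<Longrightarrow> f (ws l) i = y i" by auto
    \<comment> \<open>The finite lifts share the past of \<open>x\<close>; a cluster point lifts all
      of \<open>y\<close>.\<close>
    obtain w where w: "w \<in> X" "\<And>N k. \<exists>n\<ge>k. agree w (ws n) N"
      using cluster_point_in[OF X finite subset_UNIV, of ws] ws(1) by blast
    have "w i = x i" if "i < 0" for i
    proof -
      obtain n where "agree w (ws n) (nat \<bar>i\<bar>)" using w(2)[of 0 "nat \<bar>i\<bar>"] by auto
      then show ?thesis using ws(2)[of i n] that agreeD[of w "ws n" _ i] by simp
    qed
    moreover have "f w i = y i" for i
    proof -
      obtain n where n: "n \<ge> nat \<bar>i\<bar> + 1" "agree w (ws n) (nat \<bar>i\<bar> + r)" using w(2) by blast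
      have "f w i = f (ws n) i"
        by (rule local[OF w(1) ws(1)]) (rule agreeD[OF n(2)], linarith)
      then show ?thesis using ws(3)[of i n] n(1) by simp
    qed
    ultimately show "\<exists>x'\<in>X. (\<forall>i<0. x' i = x i) \<and> f x' = y" using w(1) by blast
  qed
qed

end

section \<open>Lifting to the Fischer cover\<close>

lemma factor_mapI:
  assumes im: "f ` X = Y" and tr1: "\<And>x. x \<in> X \<Longrightarrow> f (tr 1 x) = tr 1 (f x)"
    and local: "\<And>x y i. x \<in> X \<Longrightarrow> y \<in> X \<Longrightarrow> (\<And>j. \<bar>j - i\<bar> \<le> int R \<Longrightarrow> x j = y j) \<Longrightarrow> f x i = f y i"
  shows "factor_map f X Y"
  unfolding factor_map_def shift_eq_tr
proof (intro conjI ballI allI)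
  fix x N assume x: "x \<in> X"
  have "agree (f x) (f y) N" if y: "y \<in> X" and ag: "agree x y (N + R)" for y
    unfolding agree_def
  proof (intro allI impI)
    fix i assume i: "\<bar>i\<bar> \<le> int N"
    show "f x i = f y i"
    proof (rule local[OF x y])
      fix j assume "\<bar>j - i\<bar> \<le> int R"
      then have "\<bar>j\<bar> \<le> int (N + R)" using i by linarith
      then show "x j = y j" by (rule agreeD[OF ag])
    qed
  qed
  then show "\<exists>M. \<forall>y\<in>X. agree x y M \<longrightarrow> agree (f x) (f y) N" by blast
qed (use im tr1 in auto)

lemma word_Suc: "word x i (Suc n) = x i # word x (i + 1) n"
  using word_append[of x i 1 n] by (simp add: word_def)

locale fischer =
  fixes Y :: "(int \<Rightarrow> 'b) set" and S :: "(int \<Rightarrow> 'c::finite) set" and p :: "'c \<Rightarrow> 'b"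
  assumes cover: "fischer_cover Y S p"
begin

lemma one_step:
  obtains E where "S = {x. \<forall>i. (x i, x (i + 1)) \<in> E}"
  using cover by (auto simp: fischer_cover_def)

lemma S_tr:
  assumes "z \<in> S"
  shows "tr k z \<in> S"
proof -
  obtain E where E: "S = {x. \<forall>i. (x i, x (i + 1)) \<in> E}" by (rule one_step)
  have "(z (i + k), z (i + k + 1)) \<in> E" for i using assms E by simp
  then show ?thesis by (simp add: E algebra_simps)
qed

lemma S_subshift: "subshift S"
  unfolding subshift_def shift_closed_def shift_eq_tr
proof (intro conjI allI impI)
  show "tr 1 ` S = S"
  proof (intro equalityI subsetI)
    fix x assume "x \<in> S"
    then have "tr (-1) x \<in> S" by (rule S_tr)
    then show "x \<in> tr 1 ` S" by (rule rev_image_eqI) simp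
  qed (auto intro: S_tr)
  fix x assume x: "\<forall>N. \<exists>y\<in>S. agree x y N"
  obtain E where E: "S = {x. \<forall>i. (x i, x (i + 1)) \<in> E}" by (rule one_step)
  have "(x i, x (i + 1)) \<in> E" for i
  proof -
    obtain y where y: "y \<in> S" "agree x y (nat \<bar>i\<bar> + 1)" using x by blast
    then show ?thesis
      using E agreeD[OF y(2), of i] agreeD[OF y(2), of "i + 1"] by auto
  qed
  then show "x \<in> S" by (simp add: E)
qed

lemma S_splice:
  assumes "z \<in> S" "z' \<in> S" "z k = z' k"
  shows "(\<lambda>i. if i \<le> k then z i else z' i) \<in> S"
proof -
  obtain E where E: "S = {x. \<forall>i. (x i, x (i + 1)) \<in> E}" by (rule one_step)
  have "(if i \<le> k then z i else z' i, if i + 1 \<le> k then z (i + 1) else z' (i + 1)) \<in> E" for i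
    using assms E by (cases "i = k") auto
  then show ?thesis by (simp add: E)
qed

lemma Y_eq: "Y = (\<lambda>z. p \<circ> z) ` S"
  using cover by (simp add: fischer_cover_def)

lemma label_in_Y: "z \<in> S \<Longrightarrow> p \<circ> z \<in> Y"
  by (simp add: Y_eq)

lemma lift_exists:
  assumes "y \<in> Y"
  obtains z where "z \<in> S" "p \<circ> z = y"
  using assms by (auto simp: Y_eq)

lemma Y_tr:
  assumes "y \<in> Y"
  shows "tr k y \<in> Y"
proof -
  obtain z where z: "z \<in> S" "p \<circ> z = y" using lift_exists[OF assms] .
  have "tr k y = p \<circ> tr k z" using z(2) by auto
  then show ?thesis using label_in_Y[OF S_tr[OF z(1)]] by simp
qed

lemma right_resolving:
  assumes z: "z \<in> S" "z' \<in> S" "z k = z' k" and m: "k \<le> m"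
    and lab: "\<And>i. k < i \<Longrightarrow> i \<le> m \<Longrightarrow> p (z i) = p (z' i)"
  shows "z m = z' m"
  using m lab
proof (induction m rule: int_ge_induct)
  case base
  then show ?case using z(3) by simp
next
  case (step i)
  have eq: "z i = z' i" using step by auto
  have "[z i, z (i + 1)] \<in> lang S" "[z' i, z' (i + 1)] \<in> lang S"
    using word_in_lang[OF z(1), of i 2] word_in_lang[OF z(2), of i 2]
    by (simp_all add: word_Suc word_def numeral_2_eq_2)
  moreover have "p (z (i + 1)) = p (z' (i + 1))" using step by auto
  moreover have "\<forall>a b c. [a, b] \<in> lang S \<and> [a, c] \<in> lang S \<and> p b = p c \<longrightarrow> b = c"
    using cover unfolding fischer_cover_def by (elim conjE)
  ultimately show ?case using eq by metis
qed

lemma follower_separated: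
  assumes "[a] \<in> lang S" "[b] \<in> lang S"
    "\<And>w. a # w \<in> lang S \<Longrightarrow> \<exists>w'. b # w' \<in> lang S \<and> map p (b # w') = map p (a # w)"
    "\<And>w. b # w \<in> lang S \<Longrightarrow> \<exists>w'. a # w' \<in> lang S \<and> map p (a # w') = map p (b # w)"
  shows "a = b"
proof (rule ccontr)
  assume "a \<noteq> b"
  then have "{map p (a # w) | w. a # w \<in> lang S} \<noteq> {map p (b # w) | w. b # w \<in> lang S}"
    using cover assms(1,2) unfolding fischer_cover_def by blast
  moreover have "{map p (a # w) | w. a # w \<in> lang S} \<subseteq> {map p (b # w) | w. b # w \<in> lang S}"
    using assms(3) by (smt (verit) Collect_mono)
  moreover have "{map p (b # w) | w. b # w \<in> lang S} \<subseteq> {map p (a # w) | w. a # w \<in> lang S}"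
    using assms(4) by (smt (verit) Collect_mono)
  ultimately show False by blast
qed

lemma single_in_lang: "z \<in> S \<Longrightarrow> [z i] \<in> lang S"
  using word_in_lang[of z S i 1] by (simp add: word_def)

text \<open>All states that can end the block from \<open>magic_past\<close> admit the same
  continuations, hence have equal follower sets, and follower separation identifies them.\<close>

lemma magic_word:
  obtains y0 and k0 :: nat where "y0 \<in> Y" "\<And>z z'. z \<in> S \<Longrightarrow> z' \<in> S \<Longrightarrow>
    (\<And>i. - int k0 \<le> i \<Longrightarrow> i < 0 \<Longrightarrow> p (z i) = y0 i) \<Longrightarrow>
    (\<And>i. - int k0 \<le> i \<Longrightarrow> i < 0 \<Longrightarrow> p (z' i) = y0 i) \<Longrightarrow> z (-1) = z' (-1)"
proof -
  have fin: "finite ((\<lambda>z. z (-1)) ` S)" by simp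
  have ne: "Y \<noteq> {}" using cover by (auto simp: Y_eq fischer_cover_def irreducible_def)
  have "\<exists>y0\<in>Y. \<exists>k0::nat. \<forall>y\<in>Y. \<forall>x0\<in>S. \<forall>l.
    (\<forall>i. - int k0 \<le> i \<longrightarrow> i < 0 \<longrightarrow> y i = y0 i \<and> (p \<circ> x0) i = y0 i) \<longrightarrow>
    (\<exists>x\<in>S. x (-1) = x0 (-1) \<and> (\<forall>i. - int k0 \<le> i \<longrightarrow> i < int l \<longrightarrow> (p \<circ> x) i = y i))"
  proof (rule magic_past[OF fin S_tr _ _ ne Y_tr])
    show "p \<circ> tr k x = tr k (p \<circ> x)" for x :: "int \<Rightarrow> 'c" and k by auto
    fix x x' :: "int \<Rightarrow> 'c" and l
    assume "x \<in> S" "x' \<in> S" "x (-1) = x' (-1)"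
      "\<And>i. 0 \<le> i \<Longrightarrow> i < int l \<Longrightarrow> (p \<circ> x) i = (p \<circ> x') i"
    then show "tr (int l) x (-1) = tr (int l) x' (-1)"
      using right_resolving[of x x' "-1" "int l - 1"] by simp
  qed
  then obtain y0 and k0 :: nat where y0: "y0 \<in> Y" and magic: "\<forall>y\<in>Y. \<forall>x0\<in>S. \<forall>l.
    (\<forall>i. - int k0 \<le> i \<longrightarrow> i < 0 \<longrightarrow> y i = y0 i \<and> (p \<circ> x0) i = y0 i) \<longrightarrow>
    (\<exists>x\<in>S. x (-1) = x0 (-1) \<and> (\<forall>i. - int k0 \<le> i \<longrightarrow> i < int l \<longrightarrow> (p \<circ> x) i = y i))"
    by (elim bexE exE)
  have sub: "\<exists>w'. z' (-1) # w' \<in> lang S \<and> map p (z' (-1) # w') = map p (z (-1) # w)"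
    if z: "z \<in> S" "z' \<in> S" and w: "z (-1) # w \<in> lang S"
      and y: "\<And>i. - int (Suc k0) \<le> i \<Longrightarrow> i < 0 \<Longrightarrow> p (z i) = y0 i"
        "\<And>i. - int (Suc k0) \<le> i \<Longrightarrow> i < 0 \<Longrightarrow> p (z' i) = y0 i" for z z' w
  proof -
    obtain s where s: "s \<in> S" "word s (-1) (Suc (length w)) = z (-1) # w"
      using w lang_iff[OF S_subshift, of "z (-1) # w" "-1"] by auto
    have s0: "s (-1) = z (-1)" "word s 0 (length w) = w"
      using s(2) by (simp_all add: word_Suc)
    \<comment> \<open>\<open>s'\<close> is a point of \<open>S\<close> whose labels show the magic
      block and then those of \<open>w\<close>; \<open>magic\<close> lets the state
      \<open>z' (-1)\<close> read the same labels.\<close>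
    define s' where "s' = (\<lambda>i. if i \<le> -1 then z i else s i)"
    have s': "s' \<in> S" unfolding s'_def by (rule S_splice) (use z s s0 in auto)
    have "\<exists>x\<in>S. x (-1) = z' (-1) \<and>
        (\<forall>i. - int k0 \<le> i \<longrightarrow> i < int (length w) \<longrightarrow> (p \<circ> x) i = (p \<circ> s') i)"
    proof -
      have "\<forall>i. - int k0 \<le> i \<longrightarrow> i < 0 \<longrightarrow> (p \<circ> s') i = y0 i \<and> (p \<circ> z') i = y0 i"
        using y by (auto simp: s'_def)
      then show ?thesis using magic label_in_Y[OF s'] z(2) by blast
    qed
    then obtain x where x: "x \<in> S" "x (-1) = z' (-1)"
      "\<And>i. - int k0 \<le> i \<Longrightarrow> i < int (length w) \<Longrightarrow> p (x i) = p (s' i)" by auto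
    have "map p (word x 0 (length w)) = map p (word s 0 (length w))"
      using x(3) by (simp add: list_eq_iff_nth_eq s'_def)
    moreover have "p (z' (-1)) = p (z (-1))" using y by simp
    moreover have "word x (-1) (Suc (length w)) \<in> lang S" by (rule word_in_lang[OF x(1)])
    ultimately show ?thesis
      using x(2) s0(2) by (intro exI[of _ "word x 0 (length w)"]) (simp add: word_Suc)
  qed
  show ?thesis
  \<comment> \<open>One coordinate more than \<open>k0\<close> ensures that the block is nonempty
    and fixes the label of the state itself, which belongs to the words of its follower set.\<close>
  proof (rule that[OF y0, of "Suc k0"])
    fix z z' assume "z \<in> S" "z' \<in> S"
      "\<And>i. - int (Suc k0) \<le> i \<Longrightarrow> i < 0 \<Longrightarrow> p (z i) = y0 i"
      "\<And>i. - int (Suc k0) \<le> i \<Longrightarrow> i < 0 \<Longrightarrow> p (z' i) = y0 i"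
    then show "z (-1) = z' (-1)"
      by (intro follower_separated sub single_in_lang)
  qed
qed

end

text \<open>Of the shift of finite type only the gluing property with memory \<open>M\<close> is
  kept. Locality of \<open>f\<close> holds for all sequences, so \<open>f\<close> can be evaluated
  on glued points outside \<open>X\<close>.\<close>

locale steady_closing_code = closing_code X Y f r + fischer Y S p
  for X :: "(int \<Rightarrow> 'a::finite) set" and Y :: "(int \<Rightarrow> 'b::finite) set" and f r
    and S :: "(int \<Rightarrow> 'c::finite) set" and p +
  fixes T and M :: nat
  assumes XT: "X \<subseteq> T"
    and fT: "f ` T = Y"
    and glue_T: "\<And>x y. x \<in> T \<Longrightarrow> y \<in> T \<Longrightarrow> (\<And>i. - int M \<le> i \<Longrightarrow> i < 0 \<Longrightarrow> x i = y i) \<Longrightarrow> glue x y \<in> T"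
    and f_local: "\<And>x y i. (\<And>j. i - int r \<le> j \<Longrightarrow> j \<le> i \<Longrightarrow> x j = y j) \<Longrightarrow> f x i = f y i"
begin

lemma f_in_Y: "x \<in> X \<Longrightarrow> f x \<in> Y"
  using f by (auto simp: factor_map_def)

lemma f_tr: "x \<in> X \<Longrightarrow> f (tr k x) = tr k (f x)"
  using factor_map_tr[OF f X] .

text \<open>A preimage of the magic word recurs in \<open>x\<close> arbitrarily far to the left;
  from its image on, right-resolving determines the lift. Only labels left of \<open>k\<close> are
  compared, so the two lifts may have different futures.\<close>

lemma lift_unique:
  assumes x: "left_transitive X x" and z: "z \<in> S" "z' \<in> S"
    and lab: "\<And>i. i < k \<Longrightarrow> p (z i) = f x i" "\<And>i. i < k \<Longrightarrow> p (z' i) = f x i"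
    and i: "i < k"
  shows "z i = z' i"
proof -
  obtain y0 and k0 :: nat where y0: "y0 \<in> Y" "\<And>z z'. z \<in> S \<Longrightarrow> z' \<in> S \<Longrightarrow>
    (\<And>i. - int k0 \<le> i \<Longrightarrow> i < 0 \<Longrightarrow> p (z i) = y0 i) \<Longrightarrow>
    (\<And>i. - int k0 \<le> i \<Longrightarrow> i < 0 \<Longrightarrow> p (z' i) = y0 i) \<Longrightarrow> z (-1) = z' (-1)"
    using magic_word by blast
  obtain x0 where x0: "x0 \<in> X" "f x0 = y0" using y0(1) f by (auto simp: factor_map_def)
  obtain c where c: "c \<le> i" "\<And>j. \<bar>j\<bar> \<le> int (k0 + r) \<Longrightarrow> x (j + c) = x0 j"
    using left_transitive_far[OF X x x0(1)] by blast
  have y: "f x (j + c) = y0 j" if "- int k0 \<le> j" "j < 0" for j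
  proof -
    have "f (tr c x) j = f x0 j"
      by (rule f_local) (use c(2) that in auto)
    then show ?thesis using x0(2) f_tr[OF left_transitive_in[OF x]] by simp
  qed
  have "tr c z (-1) = tr c z' (-1)"
    by (rule y0(2)[of "tr c z" "tr c z'"]) (use z S_tr[OF z(1), of c] S_tr[OF z(2), of c] y lab c(1) i in auto)
  then have "z (c - 1) = z' (c - 1)" by (simp add: algebra_simps)
  then show ?thesis
    by (rule right_resolving[OF z]) (use c(1) lab i in auto)
qed

text \<open>A continuation \<open>w\<close> of the state of \<open>x\<close> gives a point of
  \<open>Y\<close> agreeing with \<open>f x\<close> left of \<open>D\<close>, which lifts to a point
  of \<open>X\<close> with the past of \<open>x\<close>. Replacing that past by the one of
  \<open>x'\<close> stays in \<open>T\<close>, so the image is a point of \<open>Y\<close> that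
  shows \<open>w\<close> after the past of \<open>f x'\<close>. By \<open>lift_unique\<close> its
  lift passes through the state of \<open>x'\<close>. Hence both states have the same follower
  set.\<close>

lemma lift_local:
  assumes D: "\<And>x y. left_transitive X x \<Longrightarrow> y \<in> Y \<Longrightarrow>
      (\<And>i. i < int D \<Longrightarrow> y i = f x i) \<Longrightarrow> \<exists>x'\<in>X. (\<forall>i<0. x' i = x i) \<and> f x' = y"
    and x: "left_transitive X x" "left_transitive X x'"
    and z: "z \<in> S" "z' \<in> S" "p \<circ> z = f x" "p \<circ> z' = f x'"
    and eq: "\<And>i. - int (M + r + 1) \<le> i \<Longrightarrow> i < int D \<Longrightarrow> x i = x' i"
  shows "z (int D - 1) = z' (int D - 1)"
proof -
  let ?e = "int D - 1"
  have sub: "\<exists>w'. z' ?e # w' \<in> lang S \<and> map p (z' ?e # w') = map p (z ?e # w)"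
    if x: "left_transitive X x" "left_transitive X x'"
      and z: "z \<in> S" "z' \<in> S" "p \<circ> z = f x" "p \<circ> z' = f x'"
      and eq: "\<And>i. - int (M + r + 1) \<le> i \<Longrightarrow> i < int D \<Longrightarrow> x i = x' i"
      and w: "z ?e # w \<in> lang S" for x x' z z' w
  proof -
    have pz: "p (z i) = f x i" "p (z' i) = f x' i" for i
      using z(3,4) by (auto simp: fun_eq_iff)
    \<comment> \<open>Starting at -1 covers the case \<open>D = 0\<close>, where \<open>?e\<close>
      is -1; this accounts for the 1 in \<open>M + r + 1\<close>.\<close>
    have f_eq: "f x i = f x' i" if "-1 \<le> i" "i < int D" for i
      by (rule f_local) (use eq that in auto)
    obtain s where s: "s \<in> S" "word s ?e (Suc (length w)) = z ?e # w"
      using w lang_iff[OF S_subshift, of "z ?e # w" ?e] by auto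
    have s0: "s ?e = z ?e" "word s (int D) (length w) = w"
      using s(2) by (simp_all add: word_Suc)
    define s' where "s' = (\<lambda>i. if i \<le> ?e then z i else s i)"
    have s': "s' \<in> S" unfolding s'_def by (rule S_splice) (use z s s0 in auto)
    have y: "p (s' i) = f x i" if "i < int D" for i using that pz by (simp add: s'_def)
    have "\<exists>x1\<in>X. (\<forall>i<0. x1 i = x i) \<and> f x1 = p \<circ> s'"
      by (rule D[OF x(1) label_in_Y[OF s']]) (simp add: y)
    then obtain x1 where x1: "x1 \<in> X" "\<And>i. i < 0 \<Longrightarrow> x1 i = x i" "f x1 = p \<circ> s'" by auto
    define t where "t = glue x' x1"
    have tT: "t \<in> T"
      unfolding t_def using x1 eq XT left_transitive_in[OF x(2)] by (intro glue_T) auto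
    have t_neg: "f t i = f x' i" if "i < 0" for i
      by (rule f_local) (use that in \<open>simp add: t_def\<close>)
    have t_pos: "f t i = p (s' i)" if "i \<ge> 0" for i
    proof -
      have "f t i = f x1 i"
        by (rule f_local) (use that x1(2) eq in \<open>auto simp: t_def glue_def\<close>)
      then show ?thesis by (simp add: x1(3))
    qed
    have "f t \<in> Y" using fT tT by blast
    then obtain z2 where z2: "z2 \<in> S" "p \<circ> z2 = f t" by (rule lift_exists)
    have p2: "p (z2 i) = f t i" for i using z2(2) by (auto simp: fun_eq_iff)
    have "f t i = f x' i" if "i < int D" for i
      using t_neg[of i] t_pos[of i] y[OF that] f_eq[of i] that by (cases "i < 0") auto
    then have "z2 ?e = z' ?e"
      using lift_unique[OF x(2) z2(1) z(2), of "int D" ?e] pz p2 by simp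
    moreover have "map p (word z2 (int D) (length w)) = map p (word s (int D) (length w))"
      using p2 t_pos by (simp add: list_eq_iff_nth_eq s'_def)
    moreover have "p (z' ?e) = p (z ?e)" using pz f_eq[of ?e] by simp
    moreover have "word z2 ?e (Suc (length w)) \<in> lang S" by (rule word_in_lang[OF z2(1)])
    ultimately show ?thesis
      using s0(2) by (intro exI[of _ "word z2 (int D) (length w)"]) (simp add: word_Suc)
  qed
  show ?thesis
    using sub[OF x z eq] sub[OF x(2,1) z(2,1,4,3), OF eq[symmetric]] z
    by (intro follower_separated single_in_lang)
qed

text \<open>By \<open>lift_local\<close> the lift of left-transitive points is a block code, which
  density extends to \<open>X\<close>. Surjectivity and right-continuation are obtained from
  left-transitive points and passed on by compactness.\<close>

lemma ex_right_continuing: "\<exists>\<phi> n. factor_map \<phi> X S \<and> right_continuing \<phi> X S n"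
proof -
  obtain D :: nat where D: "\<And>x y. left_transitive X x \<Longrightarrow> y \<in> Y \<Longrightarrow>
      (\<And>i. i < int D \<Longrightarrow> y i = f x i) \<Longrightarrow> \<exists>x'\<in>X. (\<forall>i<0. x' i = x i) \<and> f x' = y"
    using right_continuing_left_transitive by blast
  define e where "e = int D - 1"
  define C where "C = M + r + 1"
  define B where "B = C + D + 1"
  \<comment> \<open>Coordinate \<open>i\<close> of \<open>x\<close> is aligned with
    \<open>e = D - 1\<close>, where \<open>lift_local\<close> compares lifts. The window then ends
    at \<open>i\<close>, and \<open>B\<close> bounds its extent to the left.\<close>
  define good where "good x i x' z \<longleftrightarrow> left_transitive X x' \<and> z \<in> S \<and> p \<circ> z = f x' \<and>
    (\<forall>j. - int C \<le> j \<longrightarrow> j < int D \<longrightarrow> x' j = x (j + i - e))" for x i x' z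
  define \<phi> where "\<phi> x i = (SOME c. \<exists>x' z. good x i x' z \<and> c = z e)" for x i
  have phi_eq: "\<phi> x i = z i"
    if x': "left_transitive X x'" and z: "z \<in> S" "p \<circ> z = f x'"
      and eq: "\<And>j. i - int B \<le> j \<Longrightarrow> j \<le> i \<Longrightarrow> x' j = x j" for x x' z i
  proof -
    define u where "u = tr (i - e) x'"
    define v where "v = tr (i - e) z"
    have "p \<circ> v = f u"
      unfolding u_def v_def f_tr[OF left_transitive_in[OF x']] z(2)[symmetric] by auto
    moreover have "u j = x (j + i - e)" if "- int C \<le> j" "j < int D" for j
      using eq[of "j + i - e"] that by (simp add: u_def e_def B_def algebra_simps)
    ultimately have good: "good x i u v"
      using left_transitive_tr[OF X x'] S_tr[OF z(1)] by (simp add: good_def u_def v_def)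
    have "\<exists>x' z'. good x i x' z' \<and> \<phi> x i = z' e"
      unfolding \<phi>_def by (rule someI[of "\<lambda>c. \<exists>x' z. good x i x' z \<and> c = z e" "v e"]) (use good in blast)
    then obtain u' v' where g': "good x i u' v'" "\<phi> x i = v' e" by blast
    have "v (int D - 1) = v' (int D - 1)"
      by (rule lift_local[OF D, where x = u and x' = u']) (use good g'(1) in \<open>auto simp: good_def C_def\<close>)
    then show ?thesis using g'(2) by (simp add: e_def v_def)
  qed
  have approx: "\<exists>x' z. left_transitive X x' \<and> agree x x' N \<and> z \<in> S \<and> p \<circ> z = f x' \<and>
      (\<forall>i. \<bar>i\<bar> + int B \<le> int N \<longrightarrow> \<phi> x i = z i)" if x: "x \<in> X" for x N
  proof -
    obtain x' where x': "left_transitive X x'" "agree x x' N"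
      using left_transitive_dense[OF X irr x] .
    obtain z where z: "z \<in> S" "p \<circ> z = f x'"
      using lift_exists[OF f_in_Y[OF left_transitive_in[OF x'(1)]]] .
    have "\<phi> x i = z i" if "\<bar>i\<bar> + int B \<le> int N" for i
      by (rule phi_eq[OF x'(1) z]) (use agreeD[OF x'(2)] that in auto)
    then show ?thesis using x' z by blast
  qed
  have phi_S: "\<phi> x \<in> S" if x: "x \<in> X" for x
  proof (rule subshift_closedD[OF S_subshift])
    fix N
    obtain z where "z \<in> S" "\<forall>i. \<bar>i\<bar> + int B \<le> int (N + B) \<longrightarrow> \<phi> x i = z i"
      using approx[OF x, of "N + B"] by blast
    then show "\<exists>y\<in>S. agree (\<phi> x) y N" by (auto simp: agree_def)
  qed
  have phi_f: "p (\<phi> x i) = f x i" if x: "x \<in> X" for x i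
  proof -
    define N where "N = nat \<bar>i\<bar> + B + r"
    obtain x' z where x': "left_transitive X x'" "agree x x' N" "p \<circ> z = f x'"
      "\<forall>i. \<bar>i\<bar> + int B \<le> int N \<longrightarrow> \<phi> x i = z i"
      using approx[OF x, of N] by blast
    have "f x i = f x' i"
      by (rule f_local, rule agreeD[OF x'(2)]) (auto simp: N_def)
    moreover have "p (z i) = f x' i" using x'(3) by (auto simp: fun_eq_iff)
    moreover have "\<phi> x i = z i" using x'(4) by (auto simp: N_def)
    ultimately show ?thesis by simp
  qed
  have phi_local: "\<phi> x i = \<phi> y i"
    if x: "x \<in> X" "y \<in> X" and eq: "\<And>j. \<bar>j - i\<bar> \<le> int B \<Longrightarrow> x j = y j" for x y i
  proof -
    define N where "N = nat \<bar>i\<bar> + B"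
    obtain x' z where x': "left_transitive X x'" "agree x x' N" "z \<in> S" "p \<circ> z = f x'"
      "\<forall>i. \<bar>i\<bar> + int B \<le> int N \<longrightarrow> \<phi> x i = z i"
      using approx[OF x(1), of N] by blast
    have "\<phi> y i = z i"
    proof (rule phi_eq[OF x'(1,3,4)])
      fix j assume "i - int B \<le> j" "j \<le> i"
      then show "x' j = y j" using agreeD[OF x'(2), of j] eq[of j] by (auto simp: N_def)
    qed
    moreover have "\<phi> x i = z i" using x'(5) by (auto simp: N_def)
    ultimately show ?thesis by simp
  qed
  have phi_tr: "\<phi> (tr k x) = tr k (\<phi> x)" for k x
  proof
    fix i
    have "good (tr k x) i = good x (i + k)"
      by (simp add: good_def fun_eq_iff algebra_simps)
    then show "\<phi> (tr k x) i = tr k (\<phi> x) i" by (simp add: \<phi>_def)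
  qed
  have phi_LT: "\<phi> x = z" if "left_transitive X x" "z \<in> S" "p \<circ> z = f x" for x z
    using phi_eq[OF that] by blast
  have rc_LT: "\<exists>x'\<in>X. (\<forall>i\<le>0. x' i = x i) \<and> \<phi> x' = z"
    if x: "left_transitive X x" and z: "z \<in> S" and eq: "\<And>i. i \<le> int D \<Longrightarrow> \<phi> x i = z i" for x z
  proof -
    have xX: "x \<in> X" using x by (rule left_transitive_in)
    have "p (z i) = f x i" if "i \<le> int D" for i using phi_f[OF xX, of i] eq[OF that] by simp
    \<comment> \<open>The fact \<open>D\<close> keeps coordinates left of 0 given agreement left of
      \<open>D\<close>, whereas here the bounds are \<open>i \<le> 0\<close> and
      \<open>i \<le> D\<close>; the shift by one converts between them.\<close>
    then have "\<exists>x'\<in>X. (\<forall>i<0. x' i = tr 1 x i) \<and> f x' = tr 1 (p \<circ> z)"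
      by (intro D[OF left_transitive_tr[OF X x, of 1] Y_tr[OF label_in_Y[OF z], of 1]])
        (simp add: f_tr[OF xX])
    then obtain x1 where x1: "x1 \<in> X" "\<forall>i<0. x1 i = x (i + 1)" "f x1 = tr 1 (p \<circ> z)" by auto
    define x' where "x' = tr (-1) x1"
    have x': "x' \<in> X" "\<And>i. i \<le> 0 \<Longrightarrow> x' i = x i"
      using x1(2) subshift_tr[OF X x1(1)] by (simp_all add: x'_def)
    have "f x' = p \<circ> z" unfolding x'_def f_tr[OF x1(1)] x1(3) by auto
    moreover have "left_transitive X x'"
      using left_transitive_asymptotic[OF X x x'(1), of 0] x'(2) by simp
    ultimately have "\<phi> x' = z" using phi_LT z by simp
    then show ?thesis using x' by blast
  qed
  have closed: "\<exists>x\<in>X. (\<forall>i\<in>I. x i = a i) \<and> \<phi> x = z"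
    if xs: "\<And>n. xs n \<in> X" and conv: "\<And>i. \<exists>N. \<forall>n\<ge>N. \<phi> (xs n) i = z i"
      and a: "\<And>i. i \<in> I \<Longrightarrow> \<exists>N. \<forall>n\<ge>N. xs n i = a i" for xs :: "nat \<Rightarrow> int \<Rightarrow> 'a" and z I a
  proof -
    obtain x where x: "x \<in> X" "\<And>N k. \<exists>n\<ge>k. agree x (xs n) N"
      using cluster_point_in[OF X finite subset_UNIV, of xs] xs by blast
    have "\<phi> x i = z i" for i
    proof -
      obtain N where N: "\<forall>n\<ge>N. \<phi> (xs n) i = z i" using conv by blast
      obtain n where n: "n \<ge> N" "agree x (xs n) (nat \<bar>i\<bar> + B)" using x(2) by blast
      have "\<phi> x i = \<phi> (xs n) i"
        by (rule phi_local[OF x(1) xs]) (rule agreeD[OF n(2)], linarith)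
      then show ?thesis using N n(1) by simp
    qed
    moreover have "x i = a i" if "i \<in> I" for i
    proof -
      obtain N where N: "\<forall>n\<ge>N. xs n i = a i" using a[OF \<open>i \<in> I\<close>] by blast
      obtain n where n: "n \<ge> N" "agree x (xs n) (nat \<bar>i\<bar>)" using x(2) by blast
      then show ?thesis using N agreeD[OF n(2), of i] by simp
    qed
    ultimately show ?thesis using x(1) by blast
  qed
  have onto: "\<exists>x\<in>X. \<phi> x = z" if z: "z \<in> S" for z
  proof -
    obtain x00 where "x00 \<in> X" using irr by (auto simp: irreducible_def)
    then obtain x0 where x0: "left_transitive X x0"
      using left_transitive_dense[OF X irr] by blast
    have x0S: "\<phi> x0 \<in> S" using phi_S left_transitive_in[OF x0] by blast
    have irrS: "irreducible S" using cover by (simp add: fischer_cover_def)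
    have "\<forall>N. \<exists>x. x \<in> X \<and> agree (\<phi> x) z N"
    proof
      fix N
      let ?v = "word z (- int N) (2 * N + 1)"
      \<comment> \<open>The connecting path starts at coordinate \<open>D\<close> of
        \<open>\<phi> x0\<close>: splicing there leaves the coordinates up to \<open>D\<close>
        alone, as \<open>rc_LT\<close> demands.\<close>
      obtain g where "[\<phi> x0 (int D)] @ g @ ?v \<in> lang S"
        using irreducibleD[OF irrS single_in_lang[OF x0S] word_in_lang[OF z]] by blast
      then obtain s where s: "s \<in> S"
        "word s (int D) (length ([\<phi> x0 (int D)] @ g @ ?v)) = [\<phi> x0 (int D)] @ g @ ?v"
        unfolding lang_iff[OF S_subshift, of _ "int D"] by blast
      have s_nth: "s (int D + int k) = ([\<phi> x0 (int D)] @ g @ ?v) ! k"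
        if "k < length ([\<phi> x0 (int D)] @ g @ ?v)" for k
        using s(2) that unfolding word_eq_list_iff by blast
      have sD: "\<phi> x0 (int D) = s (int D)" using s_nth[of 0] by simp
      define s' where "s' = (\<lambda>i. if i \<le> int D then \<phi> x0 i else s i)"
      have s': "s' \<in> S" unfolding s'_def by (rule S_splice[OF x0S s(1) sD])
      obtain x1 where x1: "x1 \<in> X" "\<phi> x1 = s'"
        using rc_LT[OF x0 s'] by (auto simp: s'_def)
      define h where "h = int D + 1 + int (length g) + int N"
      have "s' (i + h) = z i" if i: "\<bar>i\<bar> \<le> int N" for i
      proof -
        have "s (i + h) = ?v ! nat (i + int N)"
          using s_nth[of "Suc (length g + nat (i + int N))"] i
          by (auto simp: nth_append h_def algebra_simps abs_le_iff)
        also have "\<dots> = z i" using i by (auto simp: abs_le_iff)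
        finally show ?thesis using i by (auto simp: s'_def h_def abs_le_iff)
      qed
      then have "agree (\<phi> (tr h x1)) z N" by (simp add: agree_def phi_tr x1(2))
      then show "\<exists>x. x \<in> X \<and> agree (\<phi> x) z N" using subshift_tr[OF X x1(1)] by blast
    qed
    from choice[OF this] obtain xs where xs: "\<And>N. xs N \<in> X" "\<And>N. agree (\<phi> (xs N)) z N" by auto
    have conv: "\<exists>N. \<forall>n\<ge>N. \<phi> (xs n) i = z i" for i
      using agreeD[OF xs(2), of i] by (intro exI[of _ "nat \<bar>i\<bar>"]) auto
    show ?thesis using closed[OF xs(1) conv, of "{}"] by auto
  qed
  have fm: "factor_map \<phi> X S"
  proof (rule factor_mapI[of \<phi> X S B])
    show "\<phi> ` X = S" using phi_S onto by blast
  qed (auto intro: phi_tr phi_local)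
  have "\<exists>x'\<in>X. (\<forall>i\<le>0. x' i = x i) \<and> \<phi> x' = z"
    if x: "x \<in> X" and z: "z \<in> S" and eq: "\<And>i. i \<le> int D \<Longrightarrow> \<phi> x i = z i" for x z
  proof -
    \<comment> \<open>A pair \<open>q\<close> holds a left-transitive approximation of
      \<open>x\<close> and a point with the same past whose image continues with \<open>z\<close>
      after coordinate \<open>D\<close>. A cluster point of the second components is the required
      point.\<close>
    define R where "R N q \<longleftrightarrow> fst q \<in> X \<and> snd q \<in> X \<and> agree x (fst q) (N + D + B) \<and>
      (\<forall>i\<le>0. snd q i = fst q i) \<and> (\<forall>i. \<phi> (snd q) i = (if i \<le> int D then \<phi> (fst q) i else z i))"
      for N q
    have "\<forall>N. \<exists>q. R N q"
    proof
      fix N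
      obtain x1 where x1: "left_transitive X x1" "agree x x1 (N + D + B)"
        using left_transitive_dense[OF X irr x] .
      have x1X: "x1 \<in> X" using x1(1) by (rule left_transitive_in)
      have "\<phi> x1 (int D) = \<phi> x (int D)"
        by (rule phi_local[OF x1X x], rule agreeD[OF x1(2), symmetric]) linarith
      then have "\<phi> x1 (int D) = z (int D)" using eq by simp
      from S_splice[OF phi_S[OF x1X] z this]
      have "\<exists>x'\<in>X. (\<forall>i\<le>0. x' i = x1 i) \<and> \<phi> x' = (\<lambda>i. if i \<le> int D then \<phi> x1 i else z i)"
        by (rule rc_LT[OF x1(1)]) simp
      then obtain x2 where "x2 \<in> X" "\<forall>i\<le>0. x2 i = x1 i"
        "\<phi> x2 = (\<lambda>i. if i \<le> int D then \<phi> x1 i else z i)" by blast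
      then have "R N (x1, x2)" using x1X x1(2) by (simp add: R_def)
      then show "\<exists>q. R N q" by (rule exI)
    qed
    from choice[OF this] obtain q where "\<And>N. R N (q N)" by auto
    then have q: "\<And>N. fst (q N) \<in> X" "\<And>N. snd (q N) \<in> X"
      "\<And>N. agree x (fst (q N)) (N + D + B)" "\<And>N i. i \<le> 0 \<Longrightarrow> snd (q N) i = fst (q N) i"
      "\<And>N i. \<phi> (snd (q N)) i = (if i \<le> int D then \<phi> (fst (q N)) i else z i)"
      by (simp_all add: R_def)
    have "\<phi> (snd (q n)) i = z i" if "n \<ge> nat \<bar>i\<bar>" for n i
    proof (cases "i \<le> int D")
      case True
      have "\<phi> (fst (q n)) i = \<phi> x i"
        by (rule phi_local[OF q(1) x], rule agreeD[OF q(3), symmetric]) (use that in linarith)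
      then show ?thesis using q(5) True eq[OF True] by simp
    qed (simp add: q(5))
    then have conv: "\<exists>N. \<forall>n\<ge>N. \<phi> (snd (q n)) i = z i" for i by blast
    have "snd (q n) i = x i" if "i \<le> 0" "n \<ge> nat \<bar>i\<bar>" for n i
      using q(4)[OF that(1)] agreeD[OF q(3), of i n] that by simp
    then have "\<exists>N. \<forall>n\<ge>N. snd (q n) i = x i" if "i \<in> {..0}" for i using that by auto
    from closed[OF q(2) conv, of "{..0}" x, OF this] show ?thesis by auto
  qed
  then have "right_continuing \<phi> X S D"
    using fm by (auto simp: right_continuing_def)
  then show ?thesis using fm by blast
qed

end

lemma steady_imp_right_continuing:
  fixes X :: "(int \<Rightarrow> 'a::finite) set" and Y :: "(int \<Rightarrow> 'b::finite) set"
    and S :: "(int \<Rightarrow> 'c::finite) set"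
  assumes X: "sofic X" "irreducible X" and Y: "subshift Y" and cover: "fischer_cover Y S p"
    and f: "steady f X Y" "right_closing_ae f X"
  shows "\<exists>\<phi> n. factor_map \<phi> X S \<and> right_continuing \<phi> X S n"
proof -
  obtain T Phi m a where T: "SFT T" "X \<subseteq> T" "\<And>x. x \<in> X \<Longrightarrow> f x = code Phi m a x"
    "code Phi m a ` T = Y"
    using f(1) unfolding steady_def by blast
  have fXY: "f ` X = Y" using f(1) by (simp add: steady_def factor_map_def)
  \<comment> \<open>Moving the window by \<open>a\<close> removes the anticipation. This composes
    the code with a shift, under which \<open>Y\<close> and the closing condition are
    invariant.\<close>
  define F where "F = code Phi (m + a) 0"
  have F: "F x = tr (- int a) (code Phi m a x)" for x
    by (auto simp: F_def code_def algebra_simps)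
  have trY: "tr (- int a) ` Y = Y"
  proof (intro equalityI subsetI)
    fix y assume "y \<in> Y"
    then have "tr (int a) y \<in> Y" by (rule subshift_tr[OF Y])
    then show "y \<in> tr (- int a) ` Y" by (rule rev_image_eqI) simp
  qed (auto intro: subshift_tr[OF Y])
  have F_local: "F x i = F y i" if "\<And>j. i - int (m + a) \<le> j \<Longrightarrow> j \<le> i \<Longrightarrow> x j = y j" for x y i
  proof -
    have "word x (i - int (m + a)) (m + a + 0 + 1) = word y (i - int (m + a)) (m + a + 0 + 1)"
      unfolding word_eq_iff using that by auto
    then show ?thesis by (simp only: F_def code_def)
  qed
  have FX: "F x = tr (- int a) (f x)" if "x \<in> X" for x using F T(3) that by simp
  obtain M :: nat where M: "\<And>x y. x \<in> T \<Longrightarrow> y \<in> T \<Longrightarrow>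
      (\<And>i. - int M \<le> i \<Longrightarrow> i < 0 \<Longrightarrow> x i = y i) \<Longrightarrow> glue x y \<in> T"
    using sft_glue[OF T(1)] by blast
  interpret steady_closing_code X Y F "m + a" S p T M
  proof (unfold_locales)
    show "factor_map F X Y"
    proof (rule factor_mapI[of F X Y "m + a"])
      have "F ` X = tr (- int a) ` f ` X" using FX by (auto simp: image_image)
      then show "F ` X = Y" using fXY trY by simp
      show "F (tr 1 x) = tr 1 (F x)" for x
        by (auto simp: F_def code_def algebra_simps)
      show "F x i = F y i" if "\<And>j. \<bar>j - i\<bar> \<le> int (m + a) \<Longrightarrow> x j = y j" for x y i
        by (rule F_local) (use that in auto)
    qed
    have "F ` T = tr (- int a) ` code Phi m a ` T" using F by (auto simp: image_image)
    then show "F ` T = Y" using T(4) trY by simp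
    show "right_closing_ae F X"
      unfolding right_closing_ae_def
    proof (intro ballI impI)
      fix x y assume xy: "x \<in> X" "y \<in> X"
        "left_transitive X x \<and> left_transitive X y \<and> left_asymptotic x y \<and> F x = F y"
      then have "tr (int a) (F x) = tr (int a) (F y)" by simp
      then have "f x = f y" using FX xy(1,2) by simp
      then show "x = y" using f(2) xy unfolding right_closing_ae_def by blast
    qed
    show "F x i = F y i"
      if "x \<in> X" "y \<in> X" "\<And>j. i - int (m + a) \<le> j \<Longrightarrow> j \<le> i \<Longrightarrow> x j = y j" for x y i
      using that(3) by (rule F_local)
    show "F x i = F y i" if "\<And>j. i - int (m + a) \<le> j \<Longrightarrow> j \<le> i \<Longrightarrow> x j = y j" for x y i
      using that by (rule F_local)
    show "glue x y \<in> T" if "x \<in> T" "y \<in> T" "\<And>i. - int M \<le> i \<Longrightarrow> i < 0 \<Longrightarrow> x i = y i" for x y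
      using that by (rule M)
  qed (fact X Y cover T(2))+
  show ?thesis by (rule ex_right_continuing)
qed

section \<open>Entropy\<close>

text \<open>Fekete's lemma. The bound on every \<open>a n\<close> is kept besides the limit because
  it yields a lower bound on word counts without error term.\<close>

lemma subadditive_limit:
  fixes a :: "nat \<Rightarrow> real"
  assumes sub: "\<And>m n. a (m + n) \<le> a m + a n" and nonneg: "\<And>n. 0 \<le> a n"
  obtains L where "(\<lambda>n. a n / real n) \<longlonglongrightarrow> L" "\<And>n. L * real n \<le> a n"
proof -
  define Q where "Q = (\<lambda>n. a n / real n) ` {1..}"
  define L where "L = Inf Q"
  have bdd: "bdd_below Q" unfolding bdd_below_def Q_def using nonneg by (intro exI[of _ 0]) auto
  have L_le: "L \<le> a n / real n" if "n \<ge> 1" for n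
    unfolding L_def using that by (intro cInf_lower bdd) (auto simp: Q_def)
  have low: "L * real n \<le> a n" for n
  proof (cases "n = 0")
    case False
    then show ?thesis using L_le[of n] by (simp add: field_simps)
  qed (use nonneg[of 0] in simp)
  have mult: "a (q * m + s) \<le> real q * a m + a s" for q m s
  proof (induction q)
    case (Suc q)
    have "a (Suc q * m + s) \<le> a m + a (q * m + s)" using sub[of m "q * m + s"] by (simp add: algebra_simps)
    then show ?case using Suc by (simp add: algebra_simps)
  qed simp
  have "(\<lambda>n. a n / real n) \<longlonglongrightarrow> L"
  proof (rule LIMSEQ_I)
    fix e :: real assume e: "e > 0"
    have "Q \<noteq> {}" by (auto simp: Q_def)
    moreover have "Inf Q < L + e / 2" using e by (simp add: L_def)
    ultimately obtain v where "v \<in> Q" "v < L + e / 2" using cInf_lessD by blast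
    then obtain m where m: "m \<ge> 1" "a m / real m < L + e / 2" by (auto simp: Q_def)
    define B where "B = (\<Sum>s<m. a s)"
    have B: "a s \<le> B" if "s < m" for s
      unfolding B_def by (rule member_le_sum) (use that nonneg in auto)
    obtain N :: nat where N: "2 * B / e < real N" using reals_Archimedean2 by blast
    have "norm (a n / real n - L) < e" if n: "n \<ge> max 1 N" for n
    proof -
      have n1: "real n > 0" "real m > 0" using n m(1) by auto
      have "a n \<le> real (n div m) * a m + a (n mod m)" using mult[of "n div m" m "n mod m"] by simp
      also have "a (n mod m) \<le> B" using m(1) by (intro B) simp
      finally have "a n / real n \<le> (real (n div m) * a m + B) / real n"
        using n1 by (intro divide_right_mono) auto
      also have "\<dots> = real (n div m) / real n * a m + B / real n" by (simp add: add_divide_distrib)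
      also have "\<dots> \<le> 1 / real m * a m + B / real n"
      proof (intro add_right_mono mult_right_mono nonneg)
        have "real (n div m * m) \<le> real n" by (intro of_nat_mono) simp
        then show "real (n div m) / real n \<le> 1 / real m" using n1 by (simp add: field_simps)
      qed
      also have "\<dots> < (L + e / 2) + e / 2"
      proof (rule add_strict_mono)
        have "2 * B / e < real n" using N n by linarith
        then show "B / real n < e / 2" using n1 e by (simp add: field_simps)
      qed (use m(2) in simp)
      finally have "a n / real n < L + e" by simp
      then show ?thesis using L_le[of n] n by simp
    qed
    then show "\<exists>N. \<forall>n\<ge>N. norm (a n / real n - L) < e" by blast
  qed
  then show ?thesis using low by (rule that)
qed

section \<open>Counting words\<close>

definition words :: "(int \<Rightarrow> 'a) set \<Rightarrow> nat \<Rightarrow> 'a list set" where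
  "words X n = {w \<in> lang X. length w = n}"

lemma finite_words: "finite (words (X :: (int \<Rightarrow> 'a::finite) set) n)"
  by (rule finite_subset[OF _ finite_lists_length_eq[of UNIV n]]) (auto simp: words_def)

lemma lang_appendD:
  assumes "subshift X" "u @ v \<in> lang X"
  shows "u \<in> lang X" "v \<in> lang X"
proof -
  obtain x where x: "x \<in> X" "word x 0 (length u + length v) = u @ v"
    using assms lang_iff[OF assms(1), of "u @ v" 0] by auto
  then have "word x 0 (length u) = u" "word x (int (length u)) (length v) = v"
    by (simp_all add: word_append)
  then show "u \<in> lang X" "v \<in> lang X" using word_in_lang[OF x(1)] by metis+
qed

lemma lang_extend:
  assumes "subshift X" "w \<in> lang X"
  obtains e where "length e = k" "w @ e \<in> lang X"
proof -
  obtain x where x: "x \<in> X" "word x 0 (length w) = w"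
    using assms lang_iff[OF assms(1), of w 0] by auto
  have "word x 0 (length w + k) \<in> lang X" by (rule word_in_lang[OF x(1)])
  then show ?thesis using that[of "word x (int (length w)) k"] by (simp add: word_append x(2))
qed

lemma words_nonempty:
  assumes "X \<noteq> {}"
  shows "words X n \<noteq> {}"
proof -
  obtain x where "x \<in> X" using assms by blast
  then have "word x 0 n \<in> words X n" by (simp add: words_def word_in_lang)
  then show ?thesis by blast
qed

lemma card_words_pos:
  fixes X :: "(int \<Rightarrow> 'a::finite) set"
  shows "X \<noteq> {} \<Longrightarrow> card (words X n) > 0"
  using words_nonempty[of X n] finite_words[of X n] by (simp add: card_gt_0_iff)

lemma card_words_add:
  fixes X :: "(int \<Rightarrow> 'a::finite) set"
  assumes X: "subshift X"
  shows "card (words X (m + n)) \<le> card (words X m) * card (words X n)"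
proof -
  have "card (words X (m + n)) \<le> card (words X m \<times> words X n)"
  proof (rule card_inj_on_le)
    show "inj_on (\<lambda>w. (take m w, drop m w)) (words X (m + n))"
      by (rule inj_onI) (metis append_take_drop_id prod.inject)
    show "(\<lambda>w. (take m w, drop m w)) ` words X (m + n) \<subseteq> words X m \<times> words X n"
    proof clarify
      fix w assume "w \<in> words X (m + n)"
      then show "take m w \<in> words X m \<and> drop m w \<in> words X n"
        using lang_appendD[OF X, of "take m w" "drop m w"] by (auto simp: words_def)
    qed
  qed (simp add: finite_words)
  then show ?thesis by (simp add: card_cartesian_product)
qed

text \<open>As \<open>lim\<close> is a description operator, the limit in \<open>entropy\<close>
  must first be shown to exist; subadditivity of the logarithm of the word count supplies
  it.\<close>

lemma entropy_bounds:
  fixes X :: "(int \<Rightarrow> 'a::finite) set"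
  assumes X: "subshift X" "X \<noteq> {}"
  shows "(\<lambda>n. ln (real (card (words X n))) / real n) \<longlonglongrightarrow> entropy X"
    and "exp (entropy X * real n) \<le> real (card (words X n))"
proof -
  define a where "a n = ln (real (card (words X n)))" for n
  have pos: "card (words X n) > 0" for n by (rule card_words_pos[OF X(2)])
  have "a (m + n) \<le> a m + a n" for m n
  proof -
    have "real (card (words X (m + n))) \<le> real (card (words X m)) * real (card (words X n))"
      using card_words_add[OF X(1), of m n] by (metis of_nat_mono of_nat_mult)
    then have "a (m + n) \<le> ln (real (card (words X m)) * real (card (words X n)))"
      unfolding a_def using pos by (subst ln_le_cancel_iff) auto
    then show ?thesis using pos by (simp add: a_def ln_mult)
  qed
  moreover have "0 \<le> a n" for n
  proof -
    have "real (card (words X n)) \<ge> 1" using pos[of n] by linarith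
    then show ?thesis by (simp add: a_def)
  qed
  ultimately obtain L where L: "(\<lambda>n. a n / real n) \<longlonglongrightarrow> L" "\<And>n. L * real n \<le> a n"
    using subadditive_limit by blast
  have "entropy X = L"
    unfolding entropy_def using limI[OF L(1)] by (simp add: a_def words_def)
  then show "(\<lambda>n. ln (real (card (words X n))) / real n) \<longlonglongrightarrow> entropy X"
    and "exp (entropy X * real n) \<le> real (card (words X n))"
    using L(1) L(2)[of n] pos[of n] by (simp_all add: a_def ln_ge_iff)
qed

section \<open>Follower sets of words, bounded gaps and synchronization\<close>

definition after :: "(int \<Rightarrow> 'a) set \<Rightarrow> 'a list \<Rightarrow> (int \<Rightarrow> 'a) set" where
  "after X u = fut X (\<lambda>x. word x (- int (length u)) (length u) = u)"

lemma finite_after: "sofic X \<Longrightarrow> finite (range (after X))"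
  by (rule finite_subset[OF _ sofic_finite_fut])
    (auto simp: after_def past_pred_def word_eq_list_iff)

lemma append_in_lang_iff:
  assumes X: "subshift X"
  shows "u @ v \<in> lang X \<longleftrightarrow> (\<exists>y\<in>after X u. word y 0 (length v) = v)"
proof
  assume "u @ v \<in> lang X"
  then obtain x where x: "x \<in> X" "word x (- int (length u)) (length u + length v) = u @ v"
    using lang_iff[OF X, of "u @ v" "- int (length u)"] by auto
  then have "word x (- int (length u)) (length u) = u" "word x 0 (length v) = v"
    by (simp_all add: word_append)
  then show "\<exists>y\<in>after X u. word y 0 (length v) = v" using x(1) by (auto simp: after_def fut_def)
next
  assume "\<exists>y\<in>after X u. word y 0 (length v) = v"
  then obtain y x where y: "word y 0 (length v) = v" and x: "x \<in> X"
    "word x (- int (length u)) (length u) = u" "\<And>i. i \<ge> 0 \<Longrightarrow> x i = y i"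
    by (auto simp: after_def fut_def)
  have "word x 0 (length v) = word y 0 (length v)" using x(3) by (simp add: word_eq_iff)
  then have "word x (- int (length u)) (length u + length v) = u @ v"
    by (simp add: word_append x(2) y)
  then show "u @ v \<in> lang X" using word_in_lang[OF x(1)] by metis
qed

text \<open>Whether \<open>w\<close> connects \<open>u\<close> to \<open>v\<close> depends only on
  the follower set of \<open>u\<close> and on \<open>before v\<close>, the follower sets that admit
  \<open>v\<close>. There are finitely many such pairs, and one connecting word for each bounds all
  gaps.\<close>

lemma bounded_gap:
  assumes X: "sofic X" "irreducible X"
  obtains K where "\<And>u v. u \<in> lang X \<Longrightarrow> v \<in> lang X \<Longrightarrow> \<exists>w. length w \<le> K \<and> u @ w @ v \<in> lang X"
proof -
  have sX: "subshift X" using X(1) by (simp add: sofic_def)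
  define before where "before v = {after X u |u. u @ v \<in> lang X}" for v
  have transfer: "u' @ w @ v' \<in> lang X"
    if "after X u = after X u'" "before v = before v'" "u @ w @ v \<in> lang X" for u u' v v' w
  proof -
    have 1: "u' @ w @ v \<in> lang X"
      using that(1,3) append_in_lang_iff[OF sX, of _ "w @ v"] by simp
    then have "after X (u' @ w) \<in> before v"
      unfolding before_def by (intro CollectI exI[of _ "u' @ w"]) simp
    then have "after X (u' @ w) \<in> before v'" using that(2) by simp
    then obtain t where "after X (u' @ w) = after X t" "t @ v' \<in> lang X" by (auto simp: before_def)
    then have "(u' @ w) @ v' \<in> lang X" unfolding append_in_lang_iff[OF sX] by simp
    then show ?thesis by simp
  qed
  define c where "c = (\<lambda>(u, v). (after X u, before v))"
  have "c ` (lang X \<times> lang X) \<subseteq> range (after X) \<times> Pow (range (after X))"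
    by (auto simp: c_def before_def)
  then have fin: "finite (c ` (lang X \<times> lang X))"
    by (rule finite_subset) (simp add: finite_after[OF X(1)])
  define g where "g q = (SOME w. \<exists>u v. c (u, v) = q \<and> u @ w @ v \<in> lang X)" for q
  define K where "K = (\<Sum>q\<in>c ` (lang X \<times> lang X). length (g q))"
  show ?thesis
  proof (rule that[of K])
    fix u v assume uv: "u \<in> lang X" "v \<in> lang X"
    obtain w where "u @ w @ v \<in> lang X" using irreducibleD[OF X(2) uv] by blast
    then have "\<exists>u' v'. c (u', v') = c (u, v) \<and> u' @ g (c (u, v)) @ v' \<in> lang X"
      unfolding g_def by (intro someI[of "\<lambda>w. \<exists>u' v'. c (u', v') = c (u, v) \<and> u' @ w @ v' \<in> lang X" w]) blast
    then obtain u' v' where "c (u', v') = c (u, v)" "u' @ g (c (u, v)) @ v' \<in> lang X" by blast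
    then have "u @ g (c (u, v)) @ v \<in> lang X"
      by (intro transfer[of u' u v' v]) (simp_all add: c_def)
    moreover have "c (u, v) \<in> c ` (lang X \<times> lang X)" using uv by blast
    then have "length (g (c (u, v))) \<le> K"
      unfolding K_def by (rule member_le_sum) (simp_all add: fin)
    ultimately show "\<exists>w. length w \<le> K \<and> u @ w @ v \<in> lang X" by blast
  qed
qed

text \<open>Bounded gaps make the count supermultiplicative up to a constant,
  \<open>c a * c b \<le> C * c (a + b)\<close>. Iterating this \<open>m\<close> times, taking
  logarithms and letting \<open>m\<close> grow bounds \<open>c a\<close>.\<close>

lemma card_words_upper:
  fixes X :: "(int \<Rightarrow> 'a::finite) set"
  assumes X: "sofic X" "irreducible X"
  obtains C :: real where "C > 0" "\<And>n. real (card (words X n)) \<le> C * exp (entropy X * real n)"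
proof -
  have sX: "subshift X" and ne: "X \<noteq> {}" using X by (simp_all add: sofic_def irreducible_def)
  define c where "c n = card (words X n)" for n
  have pos: "c n > 0" for n unfolding c_def by (rule card_words_pos[OF ne])
  obtain K where K: "\<And>u v. u \<in> lang X \<Longrightarrow> v \<in> lang X \<Longrightarrow> \<exists>w. length w \<le> K \<and> u @ w @ v \<in> lang X"
    using bounded_gap[OF X] by blast
  have gap: "c a * c b \<le> (K + 1) * c (a + b + K)" for a b
  proof -
    have "card (words X a \<times> words X b) \<le> card ({..K} \<times> words X (a + b + K))"
    proof (rule card_le_if_inj_on_rel[of _ _
          "\<lambda>p q. fst p = take a (snd q) \<and> snd p = take b (drop (a + fst q) (snd q))"])
      fix p assume "p \<in> words X a \<times> words X b"
      then obtain u v where p: "p = (u, v)" "u \<in> lang X" "length u = a" "v \<in> lang X" "length v = b"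
        by (auto simp: words_def)
      obtain w where w: "length w \<le> K" "u @ w @ v \<in> lang X" using K[OF p(2,4)] by blast
      obtain e where e: "length e = K - length w" "(u @ w @ v) @ e \<in> lang X"
        using lang_extend[OF sX w(2)] .
      show "\<exists>q. q \<in> {..K} \<times> words X (a + b + K) \<and>
          (fst p = take a (snd q) \<and> snd p = take b (drop (a + fst q) (snd q)))"
        by (rule exI[of _ "(length w, u @ w @ v @ e)"]) (use p w e in \<open>auto simp: words_def\<close>)
    qed (auto simp: finite_words prod_eq_iff)
    then show ?thesis by (simp add: c_def card_cartesian_product)
  qed
  \<comment> \<open>\<open>K + 1\<close> counts the possible gap lengths, and \<open>c K\<close>
    pays for the \<open>K\<close> extra symbols.\<close>
  define C where "C = real ((K + 1) * c K)"
  have C1: "C \<ge> 1" using pos[of K] unfolding C_def by (metis One_nat_def Suc_leI add_gr_0 mult_pos_pos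
        nat_0_less_mult_iff of_nat_1 of_nat_mono zero_less_one)
  have super: "real (c a) * real (c b) \<le> C * real (c (a + b))" for a b
  proof -
    have "c a * c b \<le> (K + 1) * (c (a + b) * c K)"
      using gap[of a b] card_words_add[OF sX, of "a + b" K] unfolding c_def
      by (meson le_trans mult_le_mono2)
    then have "real (c a * c b) \<le> real ((K + 1) * (c (a + b) * c K))" by (rule of_nat_mono)
    then show ?thesis by (simp add: C_def algebra_simps)
  qed
  have pow: "real (c a) ^ m \<le> C ^ m * real (c (m * a))" for a m
  proof (induction m)
    case 0
    then show ?case using pos[of 0] by simp
  next
    case (Suc m)
    have "real (c a) ^ Suc m \<le> real (c a) * (C ^ m * real (c (m * a)))"
      using Suc by (simp add: mult_left_mono)
    also have "\<dots> = C ^ m * (real (c a) * real (c (m * a)))" by simp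
    also have "\<dots> \<le> C ^ m * (C * real (c (a + m * a)))"
      using super C1 by (intro mult_left_mono) auto
    finally show ?case by (simp add: algebra_simps)
  qed
  have "real (c a) \<le> C * exp (entropy X * real a)" for a
  proof (cases "a = 0")
    case True
    have "words X 0 \<subseteq> {[]}" by (auto simp: words_def)
    then have "c 0 \<le> 1" unfolding c_def by (metis card.empty card_insert_disjoint card_mono empty_iff
          finite.emptyI finite.insertI One_nat_def)
    then show ?thesis using True C1 by simp
  next
    case False
    have "(ln (real (c a)) - ln C) / real a \<le> ln (real (c (Suc m * a))) / real (Suc m * a)" for m
    proof -
      have "ln (real (c a) ^ Suc m) \<le> ln (C ^ Suc m * real (c (Suc m * a)))"
        using pow[of a "Suc m"] pos C1 by (subst ln_le_cancel_iff) auto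
      then have "real (Suc m) * ln (real (c a)) \<le> real (Suc m) * ln C + ln (real (c (Suc m * a)))"
        using pos C1 by (simp add: ln_mult ln_realpow del: of_nat_Suc power_Suc mult_Suc)
      then have "real (Suc m) * (ln (real (c a)) - ln C) \<le> ln (real (c (Suc m * a)))"
        by (simp add: algebra_simps del: of_nat_Suc mult_Suc)
      then have "real (Suc m) * (ln (real (c a)) - ln C) / (real (Suc m) * real a) \<le>
          ln (real (c (Suc m * a))) / (real (Suc m) * real a)"
        by (intro divide_right_mono) auto
      then show ?thesis
        by (simp only: of_nat_mult mult_divide_mult_cancel_left_if of_nat_eq_0_iff nat.distinct if_False)
    qed
    moreover have "(\<lambda>m. ln (real (c (Suc m * a))) / real (Suc m * a)) \<longlonglongrightarrow> entropy X"
    proof -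
      have "strict_mono (\<lambda>m. Suc m * a)" using False by (intro strict_monoI) simp
      from LIMSEQ_subseq_LIMSEQ[OF entropy_bounds(1)[OF sX ne] this] show ?thesis
        by (simp add: o_def c_def)
    qed
    ultimately have "(ln (real (c a)) - ln C) / real a \<le> entropy X"
      by (intro LIMSEQ_le_const) auto
    then have "ln (real (c a)) \<le> ln C + entropy X * real a" using False by (simp add: field_simps)
    then have "exp (ln (real (c a))) \<le> exp (ln C + entropy X * real a)" by simp
    then show ?thesis using pos[of a] C1 by (simp add: exp_add)
  qed
  then show ?thesis using that[of C] C1 by (simp add: c_def)
qed

definition avoiding :: "(int \<Rightarrow> 'a) set \<Rightarrow> 'a list \<Rightarrow> nat \<Rightarrow> 'a list set" where
  "avoiding X q n = {w \<in> words X n. \<nexists>a b. w = a @ q @ b}"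

text \<open>Inserting \<open>q\<close> at any of the \<open>n + 1\<close> places of a word avoiding \<open>q\<close> is injective up to a bounded
  factor, since the first occurrence of \<open>q\<close> in the result is near the place of insertion.\<close>
lemma card_avoiding:
  fixes X :: "(int \<Rightarrow> 'a::finite) set"
  assumes X: "sofic X" "irreducible X" and q: "q \<in> lang X"
  obtains C c :: nat where "\<And>n. (n + 1) * card (avoiding X q n) \<le> C * card (words X (n + c))"
proof -
  have sX: "subshift X" using X by (simp add: sofic_def)
  obtain K where K: "\<And>u v. u \<in> lang X \<Longrightarrow> v \<in> lang X \<Longrightarrow> \<exists>w. length w \<le> K \<and> u @ w @ v \<in> lang X"
    using bounded_gap[OF X] by blast
  define l where "l = length q"
  define c where "c = 2 * K + l"
  define t where "t R = (LEAST t. take l (drop t R) = q)" for R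
  have "(n + 1) * card (avoiding X q n) \<le> ((K + 1) * ((K + 1) * (K + l + 1))) * card (words X (n + c))" for n
  proof -
    let ?D = "{..K} \<times> {..K} \<times> {..K + l} \<times> words X (n + c)"
    \<comment> \<open>\<open>i\<close> and \<open>j\<close> are the gap lengths, and
      \<open>d\<close> is the distance from the insertion place \<open>s\<close> to the end of the
      first occurrence of \<open>q\<close> in \<open>R\<close>. That occurrence starts no later than
      \<open>s + i\<close> and cannot end before \<open>s\<close>, as \<open>W\<close> avoids
      \<open>q\<close>; so \<open>d \<le> K + l\<close>, and the code returns \<open>s\<close> and
      then \<open>W\<close>.\<close>
    let ?r = "\<lambda>(s, W) (i, j, d, R). d + s = t R + l \<and>
        W = take s R @ take (n - s) (drop (s + i + l + j) R)"
    have "card ({..n} \<times> avoiding X q n) \<le> card ?D"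
    proof (rule card_le_if_inj_on_rel[of _ _ ?r])
      show "finite ?D" by (simp add: finite_words)
      fix sW assume "sW \<in> {..n} \<times> avoiding X q n"
      then obtain s W where sW: "sW = (s, W)" "s \<le> n" "W \<in> avoiding X q n" by auto
      then have W: "W \<in> lang X" "length W = n" "\<And>a b. W \<noteq> a @ q @ b"
        by (auto simp: avoiding_def words_def)
      have UV: "take s W \<in> lang X" "drop s W \<in> lang X"
        using lang_appendD[OF sX, of "take s W" "drop s W"] W(1) by simp_all
      obtain w where w: "length w \<le> K" "take s W @ w @ q \<in> lang X" using K[OF UV(1) q] by blast
      obtain w' where w': "length w' \<le> K" "(take s W @ w @ q) @ w' @ drop s W \<in> lang X"
        using K[OF w(2) UV(2)] by blast
      obtain e where e: "length e = 2 * K - length w - length w'"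
        "((take s W @ w @ q) @ w' @ drop s W) @ e \<in> lang X"
        using lang_extend[OF sX w'(2)] .
      define R where "R = take s W @ w @ q @ w' @ drop s W @ e"
      have lenU: "length (take s W) = s" using W(2) sW(2) by simp
      have RX: "R \<in> words X (n + c)"
        using e w(1) w'(1) W(2) sW(2) by (simp add: words_def R_def c_def l_def)
      have occ: "take l (drop (s + length w) R) = q"
        using lenU by (simp add: R_def l_def)
      have t_le: "t R \<le> s + length w" unfolding t_def by (rule Least_le) (rule occ)
      have tR: "take l (drop (t R) R) = q" unfolding t_def by (rule LeastI) (rule occ)
      have t_gt: "s < t R + l \<or> s = t R + l"
      proof (rule ccontr)
        assume "\<not> ?thesis"
        then have le: "t R + l \<le> s" by simp
        then have "take l (drop (t R) (take s W)) = q"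
          using tR lenU by (simp add: R_def)
        then have "W = take (t R) (take s W) @ q @ drop l (drop (t R) (take s W)) @ drop s W"
          by (metis append.assoc append_take_drop_id)
        then show False using W(3) by blast
      qed
      have "?r (s, W) (length w, length w', t R + l - s, R)"
        using t_gt lenU W(2) by (auto simp: R_def l_def)
      then show "\<exists>b. b \<in> ?D \<and> ?r sW b"
        using sW(1) RX w(1) w'(1) t_le
        by (intro exI[of _ "(length w, length w', t R + l - s, R)"]) auto
    next
      fix sW sW' b assume r: "?r sW b" "?r sW' b"
      obtain s W s' W' i j d R where eqs: "sW = (s, W)" "sW' = (s', W')" "b = (i, j, d, R)"
        by (metis surj_pair)
      have "s = s'" using r by (simp add: eqs)
      then show "sW = sW'" using r by (simp add: eqs)
    qed
    then show ?thesis by (simp add: card_cartesian_product algebra_simps)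
  qed
  then show ?thesis by (rule that)
qed

text \<open>\<open>w\<close> is chosen with minimal follower set. Prolonging \<open>w\<close> to the
  left can only shrink this set, so it is the same for every longer block of the past of
  \<open>x\<close>, and any future of \<open>w\<close> can follow each of them. Closedness of
  \<open>X\<close> passes from blocks to the whole past.\<close>

lemma synchronizing_word:
  assumes X: "sofic X" "X \<noteq> {}"
  obtains w where "w \<in> lang X" "\<And>x y. x \<in> X \<Longrightarrow> y \<in> X \<Longrightarrow> word x (- int (length w)) (length w) = w \<Longrightarrow>
    word y (- int (length w)) (length w) = w \<Longrightarrow> glue x y \<in> X"
proof -
  have sX: "subshift X" using X by (simp add: sofic_def)
  have "[] \<in> lang X" using X(2) word_in_lang[of _ X 0 0] by (auto simp: word_def)
  then have "after X ` lang X \<noteq> {}" by blast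
  moreover have "finite (after X ` lang X)"
    by (rule finite_subset[OF _ finite_after[OF X(1)]]) blast
  ultimately have "\<exists>Q\<in>after X ` lang X. \<forall>Q'\<in>after X ` lang X. Q' \<subseteq> Q \<longrightarrow> Q = Q'"
    by (intro finite_has_minimal)
  then obtain Q where Q: "Q \<in> after X ` lang X" "\<forall>Q'\<in>after X ` lang X. Q' \<subseteq> Q \<longrightarrow> Q = Q'"
    by (elim bexE)
  then obtain w where w: "w \<in> lang X" "Q = after X w" by blast
  show ?thesis
  proof (rule that[OF w(1)])
    fix x y assume x: "x \<in> X" "word x (- int (length w)) (length w) = w"
      and y: "y \<in> X" "word y (- int (length w)) (length w) = w"
    show "glue x y \<in> X"
    proof (rule subshift_closedD[OF sX])
      fix N
      define k where "k = N + length w"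
      define u where "u = word x (- int k) k"
      have u: "u \<in> lang X" unfolding u_def by (rule word_in_lang[OF x(1)])
      have "word z (- int (length w)) (length w) = w" if "word z (- int k) k = u" for z
      proof -
        have "z (- int k + int i) = x (- int k + int i)" if "i < k" for i
          using \<open>word z (- int k) k = u\<close> that unfolding u_def word_eq_iff by blast
        from this[of "N + _"] have "word z (- int (length w)) (length w) = word x (- int (length w)) (length w)"
          unfolding word_eq_iff by (simp add: k_def)
        then show ?thesis using x(2) by simp
      qed
      then have "after X u \<subseteq> after X w" by (auto simp: after_def fut_def u_def)
      then have "after X u = after X w" using Q(2) u w(2) by blast
      moreover have "y \<in> after X w" using y by (auto simp: after_def fut_def)
      ultimately have "y \<in> after X u" by simp
      then obtain v where v: "v \<in> X" "word v (- int k) k = u" "\<And>i. i \<ge> 0 \<Longrightarrow> v i = y i"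
        by (auto simp: after_def fut_def u_def)
      have "v i = x i" if "- int k \<le> i" "i < 0" for i
      proof -
        have "nat (i + int k) < k" using that by auto
        then have "v (- int k + int (nat (i + int k))) = x (- int k + int (nat (i + int k)))"
          using v(2) unfolding u_def word_eq_iff by blast
        then show ?thesis using that by simp
      qed
      then have "agree (glue x y) v N"
        using v(3) by (auto simp: agree_def glue_def k_def)
      then show "\<exists>z\<in>X. agree (glue x y) z N" using v(1) by blast
    qed
  qed
qed

section \<open>Right-continuing factors of the cover\<close>

text \<open>Lexicographically least preimages avoid \<open>q\<close>, as an occurrence of \<open>q = x[-A, k]\<close> could be
  replaced by one of \<open>y[-A, k]\<close>, the rest of the preimage being rebuilt by right-continuation.
  Hence the words avoiding \<open>q\<close> carry all the entropy of \<open>Y\<close>.\<close>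
lemma right_continuing_imp_closing_ae:
  fixes X :: "(int \<Rightarrow> 'a::finite) set" and Y :: "(int \<Rightarrow> 'b::finite) set"
    and S :: "(int \<Rightarrow> 'c::finite) set"
  assumes X: "sofic X" "irreducible X" and Y: "subshift Y"
    and ent: "entropy X = entropy Y" and cover: "fischer_cover Y S p"
    and rc: "right_continuing \<phi> X S n"
  shows "right_closing_ae (\<lambda>x. p \<circ> \<phi> x) X"
proof (rule ccontr)
  interpret fischer Y S p using cover by unfold_locales
  have sX: "subshift X" and ne: "X \<noteq> {}" using X by (simp_all add: sofic_def irreducible_def)
  have fm: "factor_map \<phi> X S" using rc by (simp add: right_continuing_def)
  have phi_S: "\<phi> x \<in> S" if "x \<in> X" for x using fm that by (auto simp: factor_map_def)
  have phi_tr: "\<phi> (tr k x) = tr k (\<phi> x)" if "x \<in> X" for k x by (rule factor_map_tr[OF fm sX that])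
  obtain R :: nat where R: "\<And>x y i. x \<in> X \<Longrightarrow> y \<in> X \<Longrightarrow>
      (\<And>j. \<bar>j - i\<bar> \<le> int R \<Longrightarrow> x j = y j) \<Longrightarrow> \<phi> x i = \<phi> y i"
    using factor_map_local[OF sX finite subset_UNIV fm] by blast
  assume "\<not> right_closing_ae (\<lambda>x. p \<circ> \<phi> x) X"
  then obtain x00 y00 where xy00: "x00 \<in> X" "y00 \<in> X" "left_transitive X x00"
    "left_asymptotic x00 y00" "p \<circ> \<phi> x00 = p \<circ> \<phi> y00" "x00 \<noteq> y00"
    unfolding right_closing_ae_def by blast
  obtain n0 where n0: "\<And>i. i \<le> n0 \<Longrightarrow> x00 i = y00 i" using xy00(4) by (auto simp: left_asymptotic_def)
  obtain i0 where i0: "x00 i0 \<noteq> y00 i0" using xy00(6) by blast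
  \<comment> \<open>\<open>n0 + d\<close> is the first coordinate at which the two points differ; it
    is moved to 0.\<close>
  define d where "d = (LEAST d. x00 (n0 + int d) \<noteq> y00 (n0 + int d))"
  have "x00 (n0 + int (nat (i0 - n0))) \<noteq> y00 (n0 + int (nat (i0 - n0)))"
    using i0 n0[of i0] by (cases "i0 \<le> n0") auto
  then have d: "x00 (n0 + int d) \<noteq> y00 (n0 + int d)" unfolding d_def by (rule LeastI)
  have d_less: "x00 (n0 + int e) = y00 (n0 + int e)" if "e < d" for e
    using not_less_Least[OF that[unfolded d_def]] by blast
  define x where "x = tr (n0 + int d) x00"
  define y where "y = tr (n0 + int d) y00"
  have xX: "x \<in> X" "y \<in> X" using subshift_tr[OF sX] xy00 by (auto simp: x_def y_def)
  have xLT: "left_transitive X x" using left_transitive_tr[OF sX xy00(3)] by (simp add: x_def)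
  have xy: "x i = y i" if "i < 0" for i
  proof (cases "i + n0 + int d \<le> n0")
    case True
    then show ?thesis using n0[of "i + (n0 + int d)"] by (simp add: x_def y_def)
  next
    case False
    then show ?thesis using d_less[of "nat (i + int d)"] that by (simp add: x_def y_def algebra_simps)
  qed
  have xy0: "x 0 \<noteq> y 0" using d by (simp add: x_def y_def)
  have pxy: "p (\<phi> x i) = p (\<phi> y i)" for i
    using xy00(5) by (simp add: x_def y_def phi_tr xy00(1,2) fun_eq_iff)
  \<comment> \<open>The common past makes \<open>\<phi> x\<close> and \<open>\<phi> y\<close> agree
    far to the left; having equal labels, they agree everywhere because \<open>p\<close> is
    right-resolving.\<close>
  have phi_xy: "\<phi> x i = \<phi> y i" for i
  proof (cases "i < - int R")
    case True
    show ?thesis by (rule R[OF xX]) (use True xy in auto)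
  next
    case False
    have "\<phi> x (- int R - 1) = \<phi> y (- int R - 1)" by (rule R[OF xX]) (use xy in auto)
    then show ?thesis
      by (rule right_resolving[OF phi_S[OF xX(1)] phi_S[OF xX(2)]]) (use False pxy in auto)
  qed
  \<comment> \<open>A synchronizing word in the past of \<open>x\<close>, found by
    left-transitivity, will allow a point containing \<open>q\<close> to be continued by
    \<open>y\<close>.\<close>
  obtain m where m: "m \<in> lang X" "\<And>x y. x \<in> X \<Longrightarrow> y \<in> X \<Longrightarrow>
      word x (- int (length m)) (length m) = m \<Longrightarrow> word y (- int (length m)) (length m) = m \<Longrightarrow> glue x y \<in> X"
    using synchronizing_word[OF X(1) ne] by blast
  obtain xm where xm: "xm \<in> X" "word xm (- int (length m)) (length m) = m"
    using m(1) lang_iff[OF sX] by blast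
  obtain c where c: "c \<le> 0" "\<And>j. \<bar>j\<bar> \<le> int (length m) \<Longrightarrow> x (j + c) = xm j"
    using left_transitive_far[OF sX xLT xm(1)] by blast
  \<comment> \<open>\<open>A\<close> reaches back over the synchronizing word, which ends at
    \<open>c\<close>, and over the \<open>2 * R\<close> coordinates needed to compare images from
    \<open>-R\<close> on; \<open>k\<close> lets \<open>q\<close> determine the image up to the
    retract \<open>n\<close>.\<close>
  define A where "A = length m + nat (- c) + 2 * R"
  define k where "k = R + n"
  define q where "q = word x (- int A) (A + k + 1)"
  have q: "q \<in> lang X" unfolding q_def by (rule word_in_lang[OF xX(1)])
  have A: "2 * int R \<le> int A" by (simp add: A_def)
  have lenq: "length q = A + k + 1" by (simp add: q_def)
  have sync: "word u (c - int (length m)) (length m) = m"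
    if "\<And>i. - int A \<le> i \<Longrightarrow> i < 0 \<Longrightarrow> u i = x i" for u
  proof -
    have "word u (c - int (length m)) (length m) = word xm (- int (length m)) (length m)"
      unfolding word_eq_iff
    proof (intro allI impI)
      fix j assume j: "j < length m"
      have "u (c - int (length m) + int j) = x (c - int (length m) + int j)"
        by (rule that) (use c(1) j in \<open>auto simp: A_def\<close>)
      also have "\<dots> = xm (- int (length m) + int j)"
        using c(2)[of "- int (length m) + int j"] j by (simp add: algebra_simps)
      finally show "u (c - int (length m) + int j) = xm (- int (length m) + int j)" .
    qed
    then show ?thesis using xm(2) by simp
  qed
  have avoid: "\<exists>x'\<in>X. \<phi> x' = z \<and> word x' 0 L \<in> avoiding X q L" if z: "z \<in> S" for z L
  proof -
    define W where "W = {word x' 0 L |x'. x' \<in> X \<and> \<phi> x' = z}"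
    \<comment> \<open>The only relation of the order is \<open>y 0 < x 0\<close>, so replacing a
      symbol \<open>x 0\<close> by \<open>y 0\<close> and leaving everything before it alone is a
      descent.\<close>
    have "wf (lex {(y 0, x 0)})"
      by (intro wf_lex) (use xy0 in \<open>auto intro!: acyclic_insert[THEN iffD2] finite_acyclic_wf simp: acyclic_def\<close>)
    moreover obtain x1 where "x1 \<in> X" "\<phi> x1 = z" using fm z by (auto simp: factor_map_def)
    then have "word x1 0 L \<in> W" by (auto simp: W_def)
    ultimately obtain w where w: "w \<in> W" "\<And>v. (v, w) \<in> lex {(y 0, x 0)} \<Longrightarrow> v \<notin> W"
      by (rule wfE_min) blast
    then obtain x' where x': "x' \<in> X" "\<phi> x' = z" "w = word x' 0 L" by (auto simp: W_def)
    have "w \<noteq> a @ q @ b" for a b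
    proof
      assume wab: "w = a @ q @ b"
      have L: "L = length a + (A + k + 1) + length b" using arg_cong[OF wab, of length] x'(3) lenq by simp
      define s where "s = length a + A"
      define x1 where "x1 = tr (int s) x'"
      have x1X: "x1 \<in> X" using subshift_tr[OF sX x'(1)] by (simp add: x1_def)
      have x1x: "x1 i = x i" if i: "- int A \<le> i" "i \<le> int k" for i
      proof -
        have len: "nat (i + int A) < length q" using i lenq by auto
        have "w ! (length a + nat (i + int A)) = q ! nat (i + int A)"
          unfolding wab using len by (simp add: nth_append)
        moreover have "w ! (length a + nat (i + int A)) = x' (int (length a + nat (i + int A)))"
          unfolding x'(3) using len L lenq by simp
        moreover have "q ! nat (i + int A) = x i"
          unfolding q_def using len lenq i by simp
        ultimately show ?thesis using i by (simp add: x1_def s_def algebra_simps)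
      qed
      \<comment> \<open>The cut is at \<open>c\<close>, where the synchronizing word ends. As
        \<open>x1\<close>, \<open>x\<close> and \<open>y\<close> agree on \<open>[-A, -1]\<close>,
        the result equals \<open>x1\<close> left of 0 and \<open>y\<close> from \<open>-A\<close>
        on.\<close>
      define v where "v = tr (- c) (glue (tr c x1) (tr c y))"
      have vX: "v \<in> X"
        unfolding v_def
      proof (intro subshift_tr[OF sX] m(2))
        show "word (tr c x1) (- int (length m)) (length m) = m"
          using sync[of x1] x1x by simp
        show "word (tr c y) (- int (length m)) (length m) = m"
          using sync[of y] xy by simp
      qed (use x1X xX subshift_tr[OF sX] in auto)
      have v_neg: "v i = x1 i" if "i < 0" for i
        using that xy[of i] x1x[of i] c(1) by (auto simp: v_def glue_def A_def)
      have v_y: "v i = y i" if "i \<ge> - int A" for i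
        using that xy[of i] x1x[of i] c(1) by (auto simp: v_def glue_def)
      have phi_v: "\<phi> v i = tr (int s) z i" if i: "i \<le> int n" for i
      proof -
        have "\<phi> v i = \<phi> x1 i"
        proof (cases "i < - int R")
          case True
          show ?thesis by (rule R[OF vX x1X]) (use True v_neg in auto)
        next
          case False
          have "\<phi> v i = \<phi> y i"
            by (rule R[OF vX xX(2)], rule v_y) (use False A in linarith)
          also have "\<dots> = \<phi> x i" by (simp add: phi_xy)
          also have "\<dots> = \<phi> x1 i"
            by (rule R[OF xX(1) x1X, OF x1x[symmetric]]) (use False i in \<open>auto simp: A_def k_def\<close>)
          finally show ?thesis .
        qed
        then show ?thesis by (simp add: x1_def phi_tr x'(1,2))
      qed
      \<comment> \<open>Right-continuation keeps \<open>v\<close> up to and including coordinate 0,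
        hence the smaller symbol \<open>y 0\<close>.\<close>
      obtain x2 where x2: "x2 \<in> X" "\<And>i. i \<le> 0 \<Longrightarrow> x2 i = v i" "\<phi> x2 = tr (int s) z"
        using rc vX S_tr[OF z, of "int s"] phi_v unfolding right_continuing_def by blast
      define x3 where "x3 = tr (- int s) x2"
      have "x3 \<in> X" using subshift_tr[OF sX x2(1)] by (simp add: x3_def)
      moreover have "\<phi> x3 = z" by (simp add: x3_def phi_tr x2(1,3))
      ultimately have "word x3 0 L \<in> W" by (auto simp: W_def)
      moreover have "(word x3 0 L, w) \<in> lex {(y 0, x 0)}"
      proof -
        have sL: "L = s + Suc (k + length b)" using L by (simp add: s_def)
        have split: "word u 0 L = word u 0 s @ u (int s) # word u (int s + 1) (k + length b)" for u :: "int \<Rightarrow> 'a"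
          unfolding sL word_append word_Suc by simp
        have "word x3 0 s = word x' 0 s"
          unfolding word_eq_iff using x2(2) v_neg by (simp add: x3_def x1_def)
        moreover have "x3 (int s) = y 0" using x2(2)[of 0] v_y[of 0] by (simp add: x3_def)
        moreover have "x' (int s) = x 0" using x1x[of 0] by (simp add: x1_def)
        ultimately show ?thesis
          unfolding lex_conv x'(3) using split[of x3] split[of x'] by auto
      qed
      ultimately show False using w(2) by blast
    qed
    then have "word x' 0 L \<in> avoiding X q L"
      using x'(3) word_in_lang[OF x'(1)] by (simp add: avoiding_def words_def)
    then show ?thesis using x'(1,2) by blast
  qed
  \<comment> \<open>A word of \<open>Y\<close> is determined by the window of a preimage with
    \<open>R\<close> further symbols at either end; by \<open>avoid\<close> this window can be taken
    free of \<open>q\<close>.\<close>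
  have cardY: "card (words Y N) \<le> card (avoiding X q (N + 2 * R))" for N
  proof (rule card_le_if_inj_on_rel[of _ _
        "\<lambda>v b. \<exists>x'\<in>X. word x' 0 (N + 2 * R) = b \<and> word (p \<circ> \<phi> x') (int R) N = v"])
    show "finite (avoiding X q (N + 2 * R))"
      by (rule finite_subset[OF _ finite_words]) (auto simp: avoiding_def)
    show "\<exists>b. b \<in> avoiding X q (N + 2 * R) \<and>
        (\<exists>x'\<in>X. word x' 0 (N + 2 * R) = b \<and> word (p \<circ> \<phi> x') (int R) N = v)"
      if v: "v \<in> words Y N" for v
    proof -
      obtain y' where y': "y' \<in> Y" "word y' (int R) N = v"
        using v lang_iff[OF Y, of v "int R"] by (auto simp: words_def)
      obtain z where z: "z \<in> S" "p \<circ> z = y'" using lift_exists[OF y'(1)] .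
      show ?thesis using avoid[OF z(1), of "N + 2 * R"] z(2) y'(2) by blast
    qed
    fix v v' b
    assume "\<exists>x'\<in>X. word x' 0 (N + 2 * R) = b \<and> word (p \<circ> \<phi> x') (int R) N = v"
      "\<exists>x'\<in>X. word x' 0 (N + 2 * R) = b \<and> word (p \<circ> \<phi> x') (int R) N = v'"
    then obtain u u' where u: "u \<in> X" "u' \<in> X" "word u 0 (N + 2 * R) = word u' 0 (N + 2 * R)"
      "word (p \<circ> \<phi> u) (int R) N = v" "word (p \<circ> \<phi> u') (int R) N = v'" by metis
    have uu: "u j = u' j" if "0 \<le> j" "j < int (N + 2 * R)" for j
      using u(3)[unfolded word_eq_iff, rule_format, of "nat j"] that by simp
    have "\<phi> u (int R + int i) = \<phi> u' (int R + int i)" if "i < N" for i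
      by (rule R[OF u(1,2)]) (use that uu in auto)
    then have "word (p \<circ> \<phi> u) (int R) N = word (p \<circ> \<phi> u') (int R) N"
      by (simp add: word_eq_iff)
    then show "v = v'" using u(4,5) by simp
  qed
  obtain C1 c1 :: nat where C1: "\<And>N. (N + 1) * card (avoiding X q N) \<le> C1 * card (words X (N + c1))"
    using card_avoiding[OF X q] by blast
  obtain C :: real where C: "C > 0" "\<And>N. real (card (words X N)) \<le> C * exp (entropy X * real N)"
    using card_words_upper[OF X] by blast
  have neY: "Y \<noteq> {}" using ne phi_S label_in_Y by blast
  define h where "h = entropy X"
  define c2 where "c2 = 2 * R + c1"
  \<comment> \<open>The exponentials cancel while the factor \<open>N + 1\<close> stays, so it would
    be bounded.\<close>
  have "real (N + 1) \<le> real C1 * (C * exp (h * real c2))" for N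
  proof -
    have "real (N + 1) * exp (h * real N) \<le> real (N + 2 * R + 1) * real (card (words Y N))"
      using entropy_bounds(2)[OF Y neY, of N] ent by (intro mult_mono) (auto simp: h_def)
    also have "\<dots> \<le> real (N + 2 * R + 1) * real (card (avoiding X q (N + 2 * R)))"
      using cardY[of N] by (intro mult_left_mono) auto
    also have "\<dots> \<le> real C1 * real (card (words X (N + 2 * R + c1)))"
      using C1[of "N + 2 * R"] by (metis of_nat_mono of_nat_mult)
    also have "\<dots> \<le> real C1 * (C * exp (h * real (N + 2 * R + c1)))"
      by (intro mult_left_mono C(2)[folded h_def]) simp
    also have "\<dots> = real C1 * (C * exp (h * real c2)) * exp (h * real N)"
      by (simp add: c2_def algebra_simps flip: exp_add)
    finally show ?thesis by simp
  qed
  moreover obtain N :: nat where "real C1 * (C * exp (h * real c2)) < real N"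
    using reals_Archimedean2 by blast
  ultimately show False by (smt (verit) of_nat_1 of_nat_add)
qed

text \<open>A block of length \<open>2 * R + 2\<close> holds two consecutive windows of
  \<open>\<phi>\<close>. If it occurs in \<open>X\<close>, the two symbols computed from it form an
  allowed transition of \<open>S\<close>. As \<open>S\<close> is one-step, allowing exactly these
  blocks defines a shift of finite type that the code sends into \<open>S\<close>.\<close>

lemma cover_factor_steady:
  fixes X :: "(int \<Rightarrow> 'a::finite) set" and S :: "(int \<Rightarrow> 'c::finite) set"
  assumes sX: "subshift X" and cover: "fischer_cover Y S p" and fm: "factor_map \<phi> X S"
  shows "steady (\<lambda>x. p \<circ> \<phi> x) X Y"
proof -
  interpret fischer Y S p using cover by unfold_locales
  obtain E where E: "S = {x. \<forall>i. (x i, x (i + 1)) \<in> E}" by (rule one_step)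
  have phi_S: "\<phi> x \<in> S" if "x \<in> X" for x using fm that by (auto simp: factor_map_def)
  obtain R :: nat where R: "\<And>x y i. x \<in> X \<Longrightarrow> y \<in> X \<Longrightarrow>
      (\<And>j. \<bar>j - i\<bar> \<le> int R \<Longrightarrow> x j = y j) \<Longrightarrow> \<phi> x i = \<phi> y i"
    using factor_map_local[OF sX finite subset_UNIV fm] by blast
  \<comment> \<open>The value is read off any point of \<open>X\<close> with \<open>w\<close> in its
    central window; by the choice of \<open>R\<close> it does not depend on which.\<close>
  define Phi where "Phi w = \<phi> (SOME x. x \<in> X \<and> word x (- int R) (R + R + 1) = w) 0" for w
  have window: "u j = v (j - i)"
    if "word u (i - int R) (R + R + 1) = word v (- int R) (R + R + 1)" "\<bar>j - i\<bar> \<le> int R"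
    for u v :: "int \<Rightarrow> 'a" and i j
  proof -
    have "nat (j - i + int R) < R + R + 1" using that(2) by auto
    then have "u (i - int R + int (nat (j - i + int R))) = v (- int R + int (nat (j - i + int R)))"
      using that(1) unfolding word_eq_iff by blast
    then show ?thesis using that(2) by (simp add: abs_le_iff)
  qed
  have Phi: "Phi (word x (i - int R) (R + R + 1)) = \<phi> x i" if x: "x \<in> X" for x i
  proof -
    define v where "v = (SOME v. v \<in> X \<and> word v (- int R) (R + R + 1) = word x (i - int R) (R + R + 1))"
    have v: "v \<in> X \<and> word v (- int R) (R + R + 1) = word x (i - int R) (R + R + 1)"
    proof -
      have "tr i x \<in> X \<and> word (tr i x) (- int R) (R + R + 1) = word x (i - int R) (R + R + 1)"
        using subshift_tr[OF sX x] by simp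
      then show ?thesis
        unfolding v_def by (rule someI[where P = "\<lambda>v. v \<in> X \<and> word v (- int R) (R + R + 1) =
          word x (i - int R) (R + R + 1)"])
    qed
    have "\<phi> v 0 = \<phi> (tr i x) 0"
      by (rule R) (use v subshift_tr[OF sX x] window[OF conjunct2[OF v, symmetric]] in auto)
    then show ?thesis by (simp add: Phi_def v_def factor_map_tr[OF fm sX x])
  qed
  define T where "T = {t. \<forall>i. word t i (2 * R + 2) \<in> lang X}"
  have "SFT T"
    unfolding sft_on_def
  proof (intro conjI exI[of _ "{w. length w = 2 * R + 2 \<and> w \<notin> lang X}"])
    show "finite {w :: 'a list. length w = 2 * R + 2 \<and> w \<notin> lang X}"
      by (rule finite_subset[OF _ finite_lists_length_eq[of UNIV "2 * R + 2"]]) auto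
    show "T = {x. range x \<subseteq> UNIV \<and> (\<forall>w\<in>{w. length w = 2 * R + 2 \<and> w \<notin> lang X}. \<not> occurs w x)}"
      by (auto simp: T_def occurs_def) (metis length_word)
  qed simp
  moreover have XT: "X \<subseteq> T" by (auto simp: T_def word_in_lang)
  \<comment> \<open>The block map has the words of \<open>X\<close> as its domain; each window of
    \<open>t\<close> is a prefix of an allowed block.\<close>
  moreover have "word t (i - int R) (R + R + 1) \<in> lang X" if "t \<in> T" for t i
  proof -
    have len: "R + R + 1 + 1 = 2 * R + 2" by simp
    have "word t (i - int R) (R + R + 1 + 1) \<in> lang X"
      using that unfolding T_def len by blast
    then have "word t (i - int R) (R + R + 1) @ word t (i - int R + int (R + R + 1)) 1 \<in> lang X"
      by (simp only: word_append)
    then show ?thesis by (rule lang_appendD[OF sX])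
  qed
  moreover have codeX: "p \<circ> \<phi> x = code (\<lambda>w. p (Phi w)) R R x" if "x \<in> X" for x
    unfolding code_def using Phi[OF that] by auto
  moreover have fXY: "(\<lambda>x. p \<circ> \<phi> x) ` X = Y"
  proof -
    have "(\<lambda>x. p \<circ> \<phi> x) ` X = (\<lambda>z. p \<circ> z) ` \<phi> ` X" by (rule image_image[symmetric])
    also have "\<phi> ` X = S" using fm by (simp add: factor_map_def)
    finally show ?thesis unfolding Y_eq .
  qed
  moreover have "code (\<lambda>w. p (Phi w)) R R ` T = Y"
  proof (intro equalityI subsetI)
    fix y assume "y \<in> Y"
    then show "y \<in> code (\<lambda>w. p (Phi w)) R R ` T" using fXY codeX XT by blast
  next
    fix y assume "y \<in> code (\<lambda>w. p (Phi w)) R R ` T"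
    then obtain t where t: "t \<in> T" "y = code (\<lambda>w. p (Phi w)) R R t" by blast
    define z where "z i = Phi (word t (i - int R) (R + R + 1))" for i
    have "(z i, z (i + 1)) \<in> E" for i
    proof -
      have "word t (i - int R) (2 * R + 2) \<in> lang X" using t(1) by (simp add: T_def)
      then obtain x where x: "x \<in> X" "word x (i - int R) (2 * R + 2) = word t (i - int R) (2 * R + 2)"
        using lang_iff[OF sX, of _ "i - int R"] by (metis length_word)
      have eq: "x (i - int R + int j) = t (i - int R + int j)" if "j < 2 * R + 2" for j
        using x(2) that unfolding word_eq_iff by blast
      have "word t (i - int R) (R + R + 1) = word x (i - int R) (R + R + 1)"
        unfolding word_eq_iff using eq by simp
      moreover have "word t (i + 1 - int R) (R + R + 1) = word x (i + 1 - int R) (R + R + 1)"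
        unfolding word_eq_iff using eq[of "Suc _"] by (simp add: algebra_simps)
      ultimately have "z i = \<phi> x i" "z (i + 1) = \<phi> x (i + 1)"
        unfolding z_def using Phi[OF x(1)] by metis+
      then show ?thesis using phi_S[OF x(1)] E by simp
    qed
    then have "z \<in> S" by (simp add: E)
    moreover have "y = p \<circ> z" by (auto simp: t(2) code_def z_def)
    ultimately show "y \<in> Y" using label_in_Y by simp
  qed
  moreover have "factor_map (\<lambda>x. p \<circ> \<phi> x) X Y"
  proof (rule factor_mapI[OF fXY])
    show "p \<circ> \<phi> (tr 1 x) = tr 1 (p \<circ> \<phi> x)" if "x \<in> X" for x
      unfolding factor_map_tr[OF fm sX that] by auto
    show "(p \<circ> \<phi> x) i = (p \<circ> \<phi> y) i"
      if "x \<in> X" "y \<in> X" "\<And>j. \<bar>j - i\<bar> \<le> int R \<Longrightarrow> x j = y j" for x y i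
      using R[OF that] by simp
  qed
  ultimately show ?thesis unfolding steady_def by blast
qed

theorem mainTheorem7:
  fixes X :: "(int \<Rightarrow> 'a::finite) set" and Y :: "(int \<Rightarrow> 'b::finite) set"
    and SY :: "(int \<Rightarrow> 'c::finite) set" and piY :: "'c \<Rightarrow> 'b"
  assumes "sofic X" "irreducible X" "sofic Y" "irreducible Y"
    and "entropy X = entropy Y"
    and "fischer_cover Y SY piY"
  shows "(\<exists>f. steady f X Y \<and> right_closing_ae f X) \<longleftrightarrow>
         (\<exists>phi n. factor_map phi X SY \<and> right_continuing phi X SY n)"
proof
  have Y: "subshift Y" using assms(3) by (simp add: sofic_def)
  assume "\<exists>f. steady f X Y \<and> right_closing_ae f X"
  then show "\<exists>phi n. factor_map phi X SY \<and> right_continuing phi X SY n"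
    using steady_imp_right_continuing[OF assms(1,2) Y assms(6)] by blast
next
  have Y: "subshift Y" and sX: "subshift X" using assms(1,3) by (simp_all add: sofic_def)
  assume "\<exists>phi n. factor_map phi X SY \<and> right_continuing phi X SY n"
  then obtain phi n where "factor_map phi X SY" "right_continuing phi X SY n" by blast
  then show "\<exists>f. steady f X Y \<and> right_closing_ae f X"
    using cover_factor_steady[OF sX assms(6)]
      right_continuing_imp_closing_ae[OF assms(1,2) Y assms(5,6)] by blast
qed

end
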